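(* Let $(n_k)_{k\ge 0}$ be a rigidity sequence. Then $(n_k)_{k\ge 0}$ is not a Kazhdan sequence, i.e. the set $\{n_k : k\ge 0\}$ is not a Kazhdan subset of $\mathbb{Z}$.
   Context: $\mathbb{T}=\{z\in\mathbb{C}: |z|=1\}$. $\mathcal{P}(\mathbb{T})$ is the set of Borel probability measures on $\mathbb{T}$. A measure $\mu\in\mathcal{P}(\mathbb{T})$ is continuous if $\mu(\{z\})=0$ for every $z\in\mathbb{T}$; $\mathcal{P}_c(\mathbb{T})$ is the set of continuous $\mu\in\mathcal{P}(\mathbb{T})$. For $n\in\mathbb{Z}$, $\widehat{\mu}(n)=\int_{\mathbb{T}} z^n\,d\mu(z)$. Rigidity sequence: a sequence of integers $(n_k)_{k\ge 0}$ is a rigidity sequence if there exists $\mu\in\mathcal{P}_c(\mathbb{T})$ such that $\widehat{\mu}(n_k)\to 1$ as $k\to\infty$. (For sequences of positive integers this is known to be equivalent to the existence of a weakly mixing measure-preserving system $(X,\mathcal{B},m;T)$ on a probability space such that $m(T^{-n_k}A\,\Delta\,A)\to 0$ for every $A\in\mathcal{B}$.) Kazhdan set: a subset $Q\subseteq\mathbb{Z}$ is a Kazhdan set if there exists $\varepsilon>0$ such that every unitary operator $U$ on a complex separable Hilbert space $H$ has the following property: if there is $x\in H$ with $\|x\|=1$ and $\sup_{n\in Q}\|U^n x-x\|<\varepsilon$, then there is a non-zero $y\in H$ with $Uy=y$. A sequence $(n_k)_{k\ge 0}$ of integers is Kazhdan if $\{n_k : k\ge 0\}$ is a Kazhdan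 set. *)

theory Defs
  imports "HOL-Probability.Probability" "HOL-Algebra.Algebraic_Closure_Type"
begin

subsection \<open>Measures on the circle and rigidity sequences\<close>

definition circle_prob :: "complex measure set" where
  "circle_prob = {\<mu>. prob_space \<mu> \<and> sets \<mu> = sets (restrict_space borel (sphere (0::complex) 1))}"

definition circle_prob_cont :: "complex measure set" where
  "circle_prob_cont = {\<mu> \<in> circle_prob. \<forall>z \<in> sphere 0 1. emeasure \<mu> {z} = 0}"

definition fourier_coeff :: "complex measure \<Rightarrow> int \<Rightarrow> complex" where
  "fourier_coeff \<mu> n = (LINT z|\<mu>. z powi n)"

definition rigidity_sequence :: "(nat \<Rightarrow> int) \<Rightarrow> bool" where
  "rigidity_sequence n \<longleftrightarrow>
     (\<exists>\<mu> \<in> circle_prob_cont. (\<lambda>k. fourier_coeff \<mu> (n k)) \<longlonglongrightarrow> 1)"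


subsection \<open>Complex separable Hilbert spaces with explicit carrier\<close>

text \<open>
  The definition of a Kazhdan set quantifies over all Hilbert spaces after \<open>\<epsilon>\<close> has been chosen, so
  spaces have to be values rather than types. The ring multiplication and unit inherited from the
  record \<open>module\<close> play no role.
\<close>

record 'a inner_module = "(complex, 'a) module" +
  ip :: "'a \<Rightarrow> 'a \<Rightarrow> complex"

definition hnorm :: "'a inner_module \<Rightarrow> 'a \<Rightarrow> real" where
  "hnorm H x = sqrt (Re (ip H x x))"

text \<open>The locale \<open>Metric_space\<close> requires nonnegativity and symmetry also off the carrier.\<close>

definition hdist :: "'a inner_module \<Rightarrow> 'a \<Rightarrow> 'a \<Rightarrow> real" where
  "hdist H x y = (if x \<in> carrier H \<and> y \<in> carrier H then hnorm H (x \<ominus>\<^bsub>H\<^esub> y) else 0)"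

locale complex_inner_space =
  module "ring_of_type_algebra :: complex ring" H for H :: "'a inner_module" (structure) +
  assumes ip_add: "\<lbrakk>x \<in> carrier H; y \<in> carrier H; z \<in> carrier H\<rbrakk> \<Longrightarrow>
      ip H (x \<oplus> y) z = ip H x z + ip H y z"
    and ip_smult: "\<lbrakk>x \<in> carrier H; y \<in> carrier H\<rbrakk> \<Longrightarrow> ip H (c \<odot> x) y = c * ip H x y"
    and ip_cnj: "\<lbrakk>x \<in> carrier H; y \<in> carrier H\<rbrakk> \<Longrightarrow> ip H y x = cnj (ip H x y)"
    and ip_nonneg: "x \<in> carrier H \<Longrightarrow> 0 \<le> Re (ip H x x)"
    and ip_definite: "\<lbrakk>x \<in> carrier H; ip H x x = 0\<rbrakk> \<Longrightarrow> x = \<zero>"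

locale separable_hilbert_space = complex_inner_space +
  assumes complete: "Metric_space.mcomplete (carrier H) (hdist H)"
    and separable: "separable_space (Metric_space.mtopology (carrier H) (hdist H))"

definition unitary_on :: "'a inner_module \<Rightarrow> ('a \<Rightarrow> 'a) \<Rightarrow> bool" where
  "unitary_on H U \<longleftrightarrow>
     bij_betw U (carrier H) (carrier H) \<and>
     (\<forall>x \<in> carrier H. \<forall>y \<in> carrier H. U (x \<oplus>\<^bsub>H\<^esub> y) = U x \<oplus>\<^bsub>H\<^esub> U y) \<and>
     (\<forall>c. \<forall>x \<in> carrier H. U (c \<odot>\<^bsub>H\<^esub> x) = c \<odot>\<^bsub>H\<^esub> U x) \<and>
     (\<forall>x \<in> carrier H. \<forall>y \<in> carrier H. ip H (U x) (U y) = ip H x y)"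

definition int_iter :: "'a inner_module \<Rightarrow> ('a \<Rightarrow> 'a) \<Rightarrow> int \<Rightarrow> 'a \<Rightarrow> 'a" where
  "int_iter H U n =
     (if 0 \<le> n then U ^^ nat n else inv_into (carrier H) U ^^ nat (- n))"


subsection \<open>Kazhdan sets\<close>

definition kazhdan_pair :: "'a itself \<Rightarrow> int set \<Rightarrow> real \<Rightarrow> bool" where
  "kazhdan_pair _ Q \<epsilon> \<longleftrightarrow>
     (\<forall>(H :: 'a inner_module) U. separable_hilbert_space H \<longrightarrow> unitary_on H U \<longrightarrow>
        (\<exists>x \<in> carrier H. hnorm H x = 1 \<and>
            (SUP n\<in>Q. ereal (hnorm H (int_iter H U n x \<ominus>\<^bsub>H\<^esub> x))) < ereal \<epsilon>) \<longrightarrow>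
        (\<exists>y \<in> carrier H. y \<noteq> \<zero>\<^bsub>H\<^esub> \<and> U y = y))"

text \<open>
  A separable Hilbert space has at most continuum many elements, hence is isomorphic to one whose
  carrier is a set of complex sequences. Letting \<open>H\<close> range over the spaces with such a carrier (and
  arbitrary operations) is therefore no restriction; see \<open>kazhdan_pair_any_type\<close> below.
\<close>

definition kazhdan_set :: "int set \<Rightarrow> bool" where
  "kazhdan_set Q \<longleftrightarrow> (\<exists>\<epsilon>>0. kazhdan_pair TYPE(nat \<Rightarrow> complex) Q \<epsilon>)"

definition kazhdan_sequence :: "(nat \<Rightarrow> int) \<Rightarrow> bool" where
  "kazhdan_sequence n \<longleftrightarrow> kazhdan_set (range n)"


subsection \<open>Independence of the carrier type\<close>

context complex_inner_space
begin

lemma smult_closed' [simp, intro]: "x \<in> carrier H \<Longrightarrow> c \<odot> x \<in> carrier H"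
  using smult_closed[of c x] by (simp add: ring_of_type_algebra_def)

lemma smult_minus1: "x \<in> carrier H \<Longrightarrow> (-1) \<odot> x = \<ominus> x"
proof -
  assume x: "x \<in> carrier H"
  have "((-1) + 1) \<odot> x = (-1) \<odot> x \<oplus> 1 \<odot> x"
    using smult_l_distr[of "-1" 1 x] x by (simp add: ring_of_type_algebra_def)
  moreover have "1 \<odot> x = x"
    using smult_one[of x] x by (simp add: ring_of_type_algebra_def)
  moreover have "0 \<odot> x = \<zero>"
    using smult_l_null[of x] x by (simp add: ring_of_type_algebra_def)
  ultimately have "(-1) \<odot> x \<oplus> x = \<zero>" by simp
  then show ?thesis using x M.minus_equality by auto
qed

lemma ip_minus: "\<lbrakk>x \<in> carrier H; y \<in> carrier H\<rbrakk> \<Longrightarrow> ip H (\<ominus> x) y = - ip H x y"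
  using ip_smult[of x y "-1"] by (simp add: smult_minus1)

lemma ip_diff: "\<lbrakk>x \<in> carrier H; y \<in> carrier H; z \<in> carrier H\<rbrakk> \<Longrightarrow>
    ip H (x \<ominus> y) z = ip H x z - ip H y z"
  by (simp add: M.minus_eq ip_add ip_minus)

lemma ip_add_right: "\<lbrakk>x \<in> carrier H; y \<in> carrier H; z \<in> carrier H\<rbrakk> \<Longrightarrow>
    ip H z (x \<oplus> y) = ip H z x + ip H z y"
  by (metis M.add.m_closed complex_cnj_add ip_add ip_cnj)

lemma ip_smult_right: "\<lbrakk>x \<in> carrier H; y \<in> carrier H\<rbrakk> \<Longrightarrow> ip H x (c \<odot> y) = cnj c * ip H x y"
  by (metis smult_closed' complex_cnj_mult ip_smult ip_cnj)

lemma ip_diff_right: "\<lbrakk>x \<in> carrier H; y \<in> carrier H; z \<in> carrier H\<rbrakk> \<Longrightarrow>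
    ip H z (x \<ominus> y) = ip H z x - ip H z y"
  by (metis M.minus_closed complex_cnj_diff ip_diff ip_cnj)

lemma ip_self: "x \<in> carrier H \<Longrightarrow> ip H x x = of_real ((hnorm H x)\<^sup>2)"
proof -
  assume x: "x \<in> carrier H"
  have "Im (ip H x x) = 0" using ip_cnj[OF x x] by (metis complex_cnj_cancel_iff cnj.sel(2) equal_neg_zero)
  then show ?thesis using ip_nonneg[OF x] by (simp add: hnorm_def complex_eq_iff)
qed

lemma hnorm_nonneg [simp]: "x \<in> carrier H \<Longrightarrow> 0 \<le> hnorm H x"
  by (simp add: hnorm_def ip_nonneg)

lemma ip_zero_left [simp]: "x \<in> carrier H \<Longrightarrow> ip H \<zero> x = 0"
  using ip_add[of "\<zero>" "\<zero>" x] by simp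

lemma ip_zero_right [simp]: "x \<in> carrier H \<Longrightarrow> ip H x \<zero> = 0"
  using ip_cnj[of "\<zero>" x] by simp

lemma hnorm_eq_0 [simp]: "x \<in> carrier H \<Longrightarrow> hnorm H x = 0 \<longleftrightarrow> x = \<zero>"
  using ip_self[of x] ip_definite[of x] by auto

lemma cauchy_schwarz:
  assumes x: "x \<in> carrier H" and y: "y \<in> carrier H"
  shows "cmod (ip H x y) \<le> hnorm H x * hnorm H y"
proof (cases "y = \<zero>")
  case True
  then show ?thesis using x y by simp
next
  case False
  define N where "N = (hnorm H y)\<^sup>2"
  have N: "N > 0" using False y by (simp add: N_def)
  define c where "c = ip H x y / of_real N"
  define z where "z = x \<ominus> c \<odot> y"
  have z: "z \<in> carrier H" using x y by (simp add: z_def)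
  have yx: "ip H y x = cnj (ip H x y)" using x y by (rule ip_cnj)
  have yy: "ip H y y = of_real N" using y by (simp add: ip_self N_def)
  have "ip H z z = ip H x x - cnj c * ip H x y - c * ip H y x + c * cnj c * ip H y y"
    using x y unfolding z_def by (simp add: ip_diff ip_diff_right ip_smult ip_smult_right algebra_simps)
  also have "\<dots> = of_real ((hnorm H x)\<^sup>2) - ip H x y * cnj (ip H x y) / of_real N"
    using N x by (simp add: yx yy c_def field_simps ip_self)
  also have "\<dots> = of_real ((hnorm H x)\<^sup>2 - (cmod (ip H x y))\<^sup>2 / N)"
    by (simp add: complex_norm_square[symmetric])
  finally have "Re (ip H z z) = (hnorm H x)\<^sup>2 - (cmod (ip H x y))\<^sup>2 / N"
    by (metis Re_complex_of_real)
  then have "(cmod (ip H x y))\<^sup>2 \<le> (hnorm H x)\<^sup>2 * N"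
    using ip_nonneg[OF z] N by (simp add: pos_divide_le_eq)
  then have "(cmod (ip H x y))\<^sup>2 \<le> (hnorm H x * hnorm H y)\<^sup>2"
    by (simp add: N_def power_mult_distrib)
  then show ?thesis
    by (rule power2_le_imp_le) (simp add: x y)
qed

lemma hnorm_add:
  assumes x: "x \<in> carrier H" and y: "y \<in> carrier H"
  shows "hnorm H (x \<oplus> y) \<le> hnorm H x + hnorm H y"
proof (rule power2_le_imp_le)
  have "ip H (x \<oplus> y) (x \<oplus> y) = ip H x x + ip H y y + (ip H x y + cnj (ip H x y))"
    using x y by (simp add: ip_add ip_add_right ip_cnj[OF x y])
  then have "(hnorm H (x \<oplus> y))\<^sup>2 = (hnorm H x)\<^sup>2 + (hnorm H y)\<^sup>2 + 2 * Re (ip H x y)"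
    using x y by (simp add: ip_self complex_eq_iff)
  also have "\<dots> \<le> (hnorm H x)\<^sup>2 + (hnorm H y)\<^sup>2 + 2 * (hnorm H x * hnorm H y)"
    using cauchy_schwarz[OF x y] complex_Re_le_cmod[of "ip H x y"] by simp
  finally show "(hnorm H (x \<oplus> y))\<^sup>2 \<le> (hnorm H x + hnorm H y)\<^sup>2"
    by (simp add: power2_sum)
qed (simp add: x y)

lemma hnorm_minus [simp]: "x \<in> carrier H \<Longrightarrow> hnorm H (\<ominus> x) = hnorm H x"
  using ip_diff_right[of "\<zero>" x "\<ominus> x"] by (simp add: hnorm_def ip_minus M.minus_eq)

lemma diff_eq_zero_iff: "\<lbrakk>x \<in> carrier H; y \<in> carrier H\<rbrakk> \<Longrightarrow> x \<ominus> y = \<zero> \<longleftrightarrow> x = y"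
  by (metis M.minus_closed M.r_neg M.minus_eq M.minus_equality M.minus_minus M.a_inv_closed)

lemma hdist_Metric_space: "Metric_space (carrier H) (hdist H)"
proof
  show "0 \<le> hdist H x y" for x y by (simp add: hdist_def)
  show "hdist H x y = hdist H y x" for x y
  proof (cases "x \<in> carrier H \<and> y \<in> carrier H")
    case True
    then have "x \<ominus> y = \<ominus> (y \<ominus> x)"
      by (simp add: M.minus_eq M.minus_add M.add.m_comm)
    then show ?thesis using True by (simp add: hdist_def)
  qed (auto simp: hdist_def)
  show "hdist H x y = 0 \<longleftrightarrow> x = y" if "x \<in> carrier H" "y \<in> carrier H" for x y
    using that by (simp add: hdist_def diff_eq_zero_iff)
  show "hdist H x z \<le> hdist H x y + hdist H y z"
    if "x \<in> carrier H" "y \<in> carrier H" "z \<in> carrier H" for x y z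
  proof -
    have "x \<ominus> z = (x \<ominus> y) \<oplus> (y \<ominus> z)"
      using that by (simp add: M.minus_eq M.add.m_assoc M.r_neg1)
    then show ?thesis using that hnorm_add[of "x \<ominus> y" "y \<ominus> z"] by (simp add: hdist_def)
  qed
qed

end

text \<open>Transport of structure along an injection of the carrier.\<close>

definition transport :: "('a \<Rightarrow> 'b) \<Rightarrow> 'a inner_module \<Rightarrow> 'b inner_module" where
  "transport f H = (let g = inv_into (carrier H) f in
     \<lparr>carrier = f ` carrier H, monoid.mult = \<lambda>_ _. undefined, one = undefined,
      ring.zero = f \<zero>\<^bsub>H\<^esub>, add = \<lambda>x y. f (g x \<oplus>\<^bsub>H\<^esub> g y),
      smult = \<lambda>c x. f (c \<odot>\<^bsub>H\<^esub> g x), ip = \<lambda>x y. ip H (g x) (g y)\<rparr>)"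

lemma transport_simps:
  "carrier (transport f H) = f ` carrier H"
  "\<zero>\<^bsub>transport f H\<^esub> = f \<zero>\<^bsub>H\<^esub>"
  "x \<oplus>\<^bsub>transport f H\<^esub> y = f (inv_into (carrier H) f x \<oplus>\<^bsub>H\<^esub> inv_into (carrier H) f y)"
  "c \<odot>\<^bsub>transport f H\<^esub> x = f (c \<odot>\<^bsub>H\<^esub> inv_into (carrier H) f x)"
  "ip (transport f H) x y = ip H (inv_into (carrier H) f x) (inv_into (carrier H) f y)"
  by (simp_all add: transport_def Let_def)

locale transport_inj = complex_inner_space H for H :: "'a inner_module" (structure) +
  fixes f :: "'a \<Rightarrow> 'b"
  assumes inj: "inj_on f (carrier H)"
begin

abbreviation "K \<equiv> transport f H"

lemma inv_f [simp]: "x \<in> carrier H \<Longrightarrow> inv_into (carrier H) f (f x) = x"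
  using inj by simp

lemma abelian_group_K: "abelian_group K"
proof (rule abelian_groupI)
  show "\<exists>y\<in>carrier K. y \<oplus>\<^bsub>K\<^esub> x = \<zero>\<^bsub>K\<^esub>" if "x \<in> carrier K" for x
  proof -
    obtain u where u: "u \<in> carrier H" "x = f u" using \<open>x \<in> carrier K\<close> by (auto simp: transport_simps)
    then show ?thesis
      by (intro bexI[of _ "f (\<ominus> u)"]) (auto simp: transport_simps M.l_neg)
  qed
qed (auto simp: transport_simps M.a_ac)

lemma inner_K: "complex_inner_space K"
proof -
  interpret K: abelian_group K by (rule abelian_group_K)
  show ?thesis
  proof (unfold_locales, goal_cases)
    case (1 a x)
    then show ?case by (auto simp: transport_simps)
  next
    case (2 a b x)
    then show ?case using smult_l_distr[of a b] by (auto simp: transport_simps)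
  next
    case (3 a x y)
    then show ?case using smult_r_distr[of a] by (auto simp: transport_simps)
  next
    case (4 a b x)
    then show ?case using smult_assoc1[of a b] by (auto simp: transport_simps)
  next
    case (5 x)
    then show ?case using smult_one by (auto simp: transport_simps)
  next
    case (8 x y)
    then show ?case by (auto simp: transport_simps intro: ip_cnj)
  qed (auto simp: transport_simps ip_add ip_smult ip_nonneg dest: ip_definite)
qed

sublocale K: complex_inner_space K by (rule inner_K)

lemma a_inv_K: "x \<in> carrier H \<Longrightarrow> \<ominus>\<^bsub>K\<^esub> f x = f (\<ominus> x)"
  by (rule K.M.minus_equality) (auto simp: transport_simps M.l_neg)

lemma minus_K: "\<lbrakk>x \<in> carrier H; y \<in> carrier H\<rbrakk> \<Longrightarrow> f x \<ominus>\<^bsub>K\<^esub> f y = f (x \<ominus> y)"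
  by (simp add: K.M.minus_eq M.minus_eq a_inv_K) (simp add: transport_simps)

lemma hnorm_K: "x \<in> carrier H \<Longrightarrow> hnorm K (f x) = hnorm H x"
  by (simp add: hnorm_def transport_simps)

lemma hdist_K: "\<lbrakk>x \<in> carrier H; y \<in> carrier H\<rbrakk> \<Longrightarrow> hdist K (f x) (f y) = hdist H x y"
  by (simp add: hdist_def minus_K hnorm_K) (simp add: transport_simps)

sublocale MH: Metric_space "carrier H" "hdist H" by (rule hdist_Metric_space)
sublocale MK: Metric_space "carrier K" "hdist K" by (rule K.hdist_Metric_space)

lemma complete_K:
  assumes "MH.mcomplete"
  shows "MK.mcomplete"
  unfolding MK.mcomplete_def
proof (intro allI impI)
  fix s assume s: "MK.MCauchy s"
  define t where "t n = inv_into (carrier H) f (s n)" for n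
  have "s n \<in> f ` carrier H" for n
    using s unfolding MK.MCauchy_def by (auto simp: transport_simps)
  then have t: "t n \<in> carrier H" and st: "s n = f (t n)" for n
    by (auto simp: t_def inv_into_into f_inv_into_f)
  have "MH.MCauchy t"
    using s t by (auto simp: MK.MCauchy_def MH.MCauchy_def st hdist_K)
  then obtain l where "limitin MH.mtopology t l sequentially"
    using assms by (auto simp: MH.mcomplete_def)
  then have l: "l \<in> carrier H" and
    lim: "\<And>e. e > 0 \<Longrightarrow> \<forall>\<^sub>F n in sequentially. t n \<in> carrier H \<and> hdist H (t n) l < e"
    by (auto simp: MH.limitin_metric)
  have "limitin MK.mtopology s (f l) sequentially"
    unfolding MK.limitin_metric using l lim t by (auto simp: st hdist_K transport_simps)
  then show "\<exists>x. limitin MK.mtopology s x sequentially" ..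
qed

lemma separable_K:
  assumes "separable_space MH.mtopology"
  shows "separable_space MK.mtopology"
proof (rule separable_space_continuous_map_image[OF assms])
  show "continuous_map MH.mtopology MK.mtopology f"
    unfolding Metric_space.metric_continuous_map[OF MH.Metric_space_axioms MK.Metric_space_axioms]
    by (auto simp: hdist_K transport_simps)
  show "f ` topspace MH.mtopology = topspace MK.mtopology"
    unfolding MH.topspace_mtopology MK.topspace_mtopology by (simp add: transport_simps)
qed

end

lemma funpow_conj:
  assumes "\<And>x. x \<in> A \<Longrightarrow> V x \<in> A" "\<And>x. x \<in> A \<Longrightarrow> W (f x) = f (V x)" "x \<in> A"
  shows "(V ^^ n) x \<in> A \<and> (W ^^ n) (f x) = f ((V ^^ n) x)"
  using assms by (induction n) auto

lemma kazhdan_pair_transport: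
  assumes K: "kazhdan_pair TYPE('b) Q \<epsilon>"
    and "separable_hilbert_space (H :: 'a inner_module)" and U: "unitary_on H U"
    and "inj_on (f :: 'a \<Rightarrow> 'b) (carrier H)"
    and x: "x \<in> carrier H" "hnorm H x = 1"
    and sup: "(SUP n\<in>Q. ereal (hnorm H (int_iter H U n x \<ominus>\<^bsub>H\<^esub> x))) < ereal \<epsilon>"
  shows "\<exists>y \<in> carrier H. y \<noteq> \<zero>\<^bsub>H\<^esub> \<and> U y = y"
proof -
  interpret separable_hilbert_space H by fact
  interpret transport_inj H f by unfold_locales fact
  have hK: "separable_hilbert_space (transport f H)"
    by unfold_locales (use complete_K[OF complete] separable_K[OF separable] in auto)
  define V where "V = f \<circ> U \<circ> inv_into (carrier H) f"
  have bij: "bij_betw U (carrier H) (carrier H)" using U by (simp add: unitary_on_def)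
  then have Uc: "U u \<in> carrier H" if "u \<in> carrier H" for u using that by (auto simp: bij_betw_def)
  have Vf: "V (f u) = f (U u)" if "u \<in> carrier H" for u using that by (simp add: V_def)
  have bijf: "bij_betw f (carrier H) (carrier K)" using inj by (simp add: bij_betw_def transport_simps)
  have bijV: "bij_betw V (carrier K) (carrier K)"
    unfolding V_def by (intro bij_betw_trans[OF bij_betw_inv_into[OF bijf]] bij_betw_trans[OF bij] bijf)
  have V: "unitary_on K V"
    using U Uc bijV by (auto simp: unitary_on_def Vf transport_simps)
  have inv_c: "inv_into (carrier H) U u \<in> carrier H" if "u \<in> carrier H" for u
    using bij that by (metis bij_betw_def inv_into_into)
  have inv_V: "inv_into (carrier K) V (f u) = f (inv_into (carrier H) U u)" if "u \<in> carrier H" for u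
  proof (rule inv_into_f_eq)
    show "inj_on V (carrier K)" using bijV by (simp add: bij_betw_def)
    show "f (inv_into (carrier H) U u) \<in> carrier K" using inv_c[OF that] by (simp add: transport_simps)
    show "V (f (inv_into (carrier H) U u)) = f u"
      using inv_c[OF that] that bij by (simp add: Vf bij_betw_inv_into_right)
  qed
  have iter: "int_iter H U n x \<in> carrier H \<and> int_iter K V n (f x) = f (int_iter H U n x)" for n
    using funpow_conj[of "carrier H" U V f x "nat n"] Uc Vf x
      funpow_conj[of "carrier H" "inv_into (carrier H) U" "inv_into (carrier K) V" f x "nat (- n)"]
      inv_c inv_V
    by (simp add: int_iter_def)
  have "(SUP n\<in>Q. ereal (hnorm K (int_iter K V n (f x) \<ominus>\<^bsub>K\<^esub> f x))) < ereal \<epsilon>"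
    using sup x iter by (simp add: minus_K hnorm_K)
  moreover have "f x \<in> carrier K" "hnorm K (f x) = 1"
    using x by (auto simp: hnorm_K) (simp add: transport_simps)
  ultimately obtain y where y: "y \<in> carrier K" "y \<noteq> \<zero>\<^bsub>K\<^esub>" "V y = y"
    using K hK V unfolding kazhdan_pair_def by blast
  then obtain u where u: "u \<in> carrier H" "y = f u" by (auto simp: transport_simps)
  then have "U u = u" using y(3) inj Uc by (metis Vf inj_onD)
  moreover have "u \<noteq> \<zero>\<^bsub>H\<^esub>" using y u by (auto simp: transport_simps)
  ultimately show ?thesis using u by blast
qed

lemma (in separable_hilbert_space) coordinates:
  "\<exists>f :: 'a \<Rightarrow> nat \<Rightarrow> complex. inj_on f (carrier H)"
proof -
  interpret MH: Metric_space "carrier H" "hdist H" by (rule hdist_Metric_space)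
  obtain D where D: "countable D" "D \<subseteq> carrier H" "MH.mtopology closure_of D = carrier H"
    using separable by (auto simp: separable_space_def)
  have D0: "D \<noteq> {}" using D(3) M.zero_closed by auto
  have "inj_on (\<lambda>x n. ip H x (from_nat_into D n)) (carrier H)"
  proof (rule inj_onI)
    fix x y assume x: "x \<in> carrier H" and y: "y \<in> carrier H"
      and eq: "(\<lambda>n. ip H x (from_nat_into D n)) = (\<lambda>n. ip H y (from_nat_into D n))"
    define z where "z = x \<ominus> y"
    have z: "z \<in> carrier H" using x y by (simp add: z_def)
    have orth: "ip H z d = 0" if "d \<in> D" for d
      using fun_cong[OF eq, of "to_nat_on D d"] that D x y
      by (auto simp: z_def ip_diff from_nat_into_to_nat_on)
    have "hnorm H z \<le> e" if "e > 0" for e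
    proof -
      have "z \<in> MH.mtopology closure_of D" using z D(3) by blast
      then obtain d where d: "d \<in> D" "hdist H z d < e"
        using \<open>e > 0\<close> unfolding MH.metric_closure_of by auto
      then have dc: "d \<in> carrier H" using D by auto
      have "of_real ((hnorm H z)\<^sup>2) = ip H z (z \<ominus> d)"
        using z dc orth[OF d(1)] by (simp add: ip_diff_right ip_self)
      then have "(hnorm H z)\<^sup>2 = cmod (ip H z (z \<ominus> d))"
        by (metis abs_of_nonneg norm_of_real zero_le_power2)
      also have "\<dots> \<le> hnorm H z * e"
        using cauchy_schwarz[OF z, of "z \<ominus> d"] z dc d(2)
          mult_left_mono[of "hnorm H (z \<ominus> d)" e "hnorm H z"]
        by (simp add: hdist_def)
      finally show ?thesis
        using hnorm_nonneg[OF z] \<open>e > 0\<close> mult_le_cancel_left_pos[of "hnorm H z" "hnorm H z" e]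
        unfolding power2_eq_square by linarith
    qed
    then have "hnorm H z = 0"
      using hnorm_nonneg[OF z] field_le_epsilon[of "hnorm H z" 0] by simp
    then show "x = y" using z x y by (simp add: z_def diff_eq_zero_iff)
  qed
  then show ?thesis by blast
qed

theorem kazhdan_pair_any_type:
  assumes "kazhdan_pair TYPE(nat \<Rightarrow> complex) Q \<epsilon>"
  shows "kazhdan_pair TYPE('a) Q \<epsilon>"
  unfolding kazhdan_pair_def
proof (intro allI impI, elim bexE conjE)
  fix H :: "'a inner_module" and U x
  assume H: "separable_hilbert_space H" and *: "unitary_on H U" "x \<in> carrier H" "hnorm H x = 1"
    "(SUP n\<in>Q. ereal (hnorm H (int_iter H U n x \<ominus>\<^bsub>H\<^esub> x))) < ereal \<epsilon>"
  obtain f :: "'a \<Rightarrow> nat \<Rightarrow> complex" where "inj_on f (carrier H)"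
    using separable_hilbert_space.coordinates[OF H] by (rule exE)
  then show "\<exists>y\<in>carrier H. y \<noteq> \<zero>\<^bsub>H\<^esub> \<and> U y = y"
    using kazhdan_pair_transport[OF assms H *(1) _ *(2-4)] by simp
qed

end

theory Submission
  imports Defs
begin

text \<open>
  Let \<open>\<mu>\<close> be a continuous measure witnessing rigidity, so that \<open>z\<^bsup>n\<^sub>k\<^esup> \<rightarrow> 1\<close> in \<open>L\<^sup>2(\<mu>)\<close>. For a Borel set
  \<open>E\<close> with \<open>\<mu>(E) > 0\<close> consider \<open>\<mu> \<otimes> \<mu>\<close> conditioned on \<open>E \<times> E\<close>, and the mean of
  \<open>|(z/w)\<^bsup>n\<^sub>k\<^esup> - 1|\<^sup>2\<close> under it. As \<open>k \<rightarrow> \<infinity>\<close> this mean tends to 0, and if \<open>E\<close> has small diameter it is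
  also small for any prescribed finite set of \<open>k\<close>. Choosing \<open>E\<^sub>1, \<dots>, E\<^sub>N\<close> successively, each small
  enough for the range of \<open>k\<close> in which the previous ones are not yet close to their limit, every \<open>k\<close>
  is bad for at most one of them, so the average of the \<open>N\<close> conditioned measures is a probability
  measure \<open>P\<close> for which the mean is small uniformly in \<open>k\<close>. Multiplication by \<open>z/w\<close> on \<open>L\<^sup>2(P)\<close> then
  almost fixes the constant function 1 along \<open>(n\<^sub>k)\<close>, but it has no invariant vector because the
  diagonal is a null set of \<open>\<mu> \<otimes> \<mu>\<close>.
\<close>

section \<open>Square-integrable functions\<close>

definition L2 :: "'a measure \<Rightarrow> ('a \<Rightarrow> complex) set" where
  "L2 M = {f \<in> borel_measurable M. integrable M (\<lambda>x. (cmod (f x))\<^sup>2)}"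

lemma norm_add_power2_le: "(norm (a + b))\<^sup>2 \<le> 2 * (norm a)\<^sup>2 + 2 * (norm b)\<^sup>2"
proof -
  have "(norm (a + b))\<^sup>2 \<le> (norm a + norm b)\<^sup>2"
    by (intro power_mono norm_triangle_ineq) auto
  also have "\<dots> \<le> 2 * (norm a)\<^sup>2 + 2 * (norm b)\<^sup>2"
    using sum_squares_bound[of "norm a" "norm b"] by (simp add: power2_sum)
  finally show ?thesis .
qed

lemma norm_diff_power2_le: "(norm (a - b))\<^sup>2 \<le> 2 * (norm a)\<^sup>2 + 2 * (norm b)\<^sup>2"
  using norm_add_power2_le[of a "- b"] by simp

lemma L2_measurable: "f \<in> L2 M \<Longrightarrow> f \<in> borel_measurable M"
  and L2_integrable: "f \<in> L2 M \<Longrightarrow> integrable M (\<lambda>x. (cmod (f x))\<^sup>2)"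
  by (auto simp: L2_def)

lemma L2_bound:
  assumes "f \<in> L2 M" "g \<in> borel_measurable M" "AE x in M. cmod (g x) \<le> C * cmod (f x)"
  shows "g \<in> L2 M"
proof -
  have "integrable M (\<lambda>x. (cmod (g x))\<^sup>2)"
  proof (rule Bochner_Integration.integrable_bound)
    show "integrable M (\<lambda>x. C\<^sup>2 * (cmod (f x))\<^sup>2)" using L2_integrable[OF assms(1)] by simp
    show "AE x in M. norm ((cmod (g x))\<^sup>2) \<le> norm (C\<^sup>2 * (cmod (f x))\<^sup>2)"
      using assms(3)
    proof eventually_elim
      case (elim x)
      then show ?case using power_mono[OF elim, of 2] by (simp add: power_mult_distrib)
    qed
  qed (use assms in measurable)
  then show ?thesis using assms by (simp add: L2_def)
qed

lemma L2_zero [simp]: "(\<lambda>_. 0) \<in> L2 M"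
  by (simp add: L2_def)

lemma L2_add [simp]:
  assumes "f \<in> L2 M" "g \<in> L2 M"
  shows "(\<lambda>x. f x + g x) \<in> L2 M"
proof -
  have "integrable M (\<lambda>x. (cmod (f x + g x))\<^sup>2)"
  proof (rule Bochner_Integration.integrable_bound)
    show "integrable M (\<lambda>x. 2 * (cmod (f x))\<^sup>2 + 2 * (cmod (g x))\<^sup>2)"
      using assms by (simp add: L2_def)
  qed (use assms in \<open>auto simp: L2_def norm_add_power2_le\<close>)
  then show ?thesis using assms by (auto simp: L2_def intro: borel_measurable_add)
qed

lemma L2_cmult [simp]: "f \<in> L2 M \<Longrightarrow> (\<lambda>x. c * f x) \<in> L2 M"
  by (auto simp: L2_def norm_mult power_mult_distrib)

lemma L2_diff [simp]: "f \<in> L2 M \<Longrightarrow> g \<in> L2 M \<Longrightarrow> (\<lambda>x. f x - g x) \<in> L2 M"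
  using L2_add[of f M "\<lambda>x. (- 1) * g x"] L2_cmult[of g M "- 1"] by simp

text \<open>The inequality between geometric and arithmetic means dominates the product by the sum
  of the squares.\<close>

lemma L2_mult_cnj_integrable:
  assumes "f \<in> L2 M" "g \<in> L2 M"
  shows "integrable M (\<lambda>x. f x * cnj (g x))"
proof (rule Bochner_Integration.integrable_bound)
  show "integrable M (\<lambda>x. (cmod (f x))\<^sup>2 + (cmod (g x))\<^sup>2)" using assms by (simp add: L2_def)
  show "AE x in M. norm (f x * cnj (g x)) \<le> norm ((cmod (f x))\<^sup>2 + (cmod (g x))\<^sup>2)"
  proof (rule AE_I2)
    fix x
    have "2 * (cmod (f x) * cmod (g x)) \<le> (cmod (f x))\<^sup>2 + (cmod (g x))\<^sup>2"
      using sum_squares_bound[of "cmod (f x)" "cmod (g x)"] by (simp add: mult.assoc)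
    moreover have "0 \<le> cmod (f x) * cmod (g x)" by simp
    ultimately show "norm (f x * cnj (g x)) \<le> norm ((cmod (f x))\<^sup>2 + (cmod (g x))\<^sup>2)"
      unfolding norm_mult complex_mod_cnj real_norm_def by linarith
  qed
  have [measurable]: "f \<in> borel_measurable M" "g \<in> borel_measurable M"
    using assms by (auto simp: L2_def)
  have "(\<lambda>x. cnj (g x)) \<in> borel_measurable M"
    by (intro borel_measurable_continuous_on[of cnj] continuous_intros) measurable
  then show "(\<lambda>x. f x * cnj (g x)) \<in> borel_measurable M" by measurable
qed

section \<open>Square-integrable functions on a probability space: completeness and closures\<close>

context prob_space
begin

lemma L2_bounded:
  assumes "f \<in> borel_measurable M" "\<And>x. x \<in> space M \<Longrightarrow> cmod (f x) \<le> C"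
  shows "f \<in> L2 M"
proof -
  have "(\<lambda>_. 1) \<in> L2 M" by (simp add: L2_def)
  then show ?thesis by (rule L2_bound[where C = C]) (use assms in auto)
qed

lemma L2_imp_integrable:
  assumes "f \<in> L2 M"
  shows "integrable M f"
proof -
  have "(\<lambda>_. 1) \<in> L2 M" by (simp add: L2_def)
  from L2_mult_cnj_integrable[OF assms this] show ?thesis by simp
qed

text \<open>Nonnegativity of the variance of the modulus. It turns an L2-Cauchy sequence into an
  L1-Cauchy one.\<close>

lemma expectation_cmod_power2_le:
  assumes "f \<in> L2 M"
  shows "(\<integral>x. cmod (f x) \<partial>M)\<^sup>2 \<le> (\<integral>x. (cmod (f x))\<^sup>2 \<partial>M)"
  using variance_positive[of "\<lambda>x. cmod (f x)"] variance_eq[of "\<lambda>x. cmod (f x)"]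
    L2_imp_integrable[OF assms] L2_integrable[OF assms] by simp

text \<open>Riesz-Fischer. The sequence is Cauchy in L1, so a subsequence converges almost
  everywhere; Fatou's lemma along that subsequence then bounds the L2 distance of every late term of
  the full sequence to the limit.\<close>

lemma L2_Cauchy_limit:
  assumes s: "\<And>i. s i \<in> L2 M"
    and Cauchy: "\<And>e. e > 0 \<Longrightarrow> \<exists>N. \<forall>i\<ge>N. \<forall>j\<ge>N. (\<integral>x. (cmod (s i x - s j x))\<^sup>2 \<partial>M) < e"
  obtains f where "f \<in> L2 M" "(\<lambda>i. \<integral>x. (cmod (s i x - f x))\<^sup>2 \<partial>M) \<longlonglongrightarrow> 0"
proof -
  have [measurable]: "s i \<in> borel_measurable M" for i using s by (rule L2_measurable)
  have "\<exists>N. \<forall>i\<ge>N. \<forall>j\<ge>N. (\<integral>x. cmod (s i x - s j x) \<partial>M) < e" if "e > 0" for e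
  proof -
    obtain N where N: "\<forall>i\<ge>N. \<forall>j\<ge>N. (\<integral>x. (cmod (s i x - s j x))\<^sup>2 \<partial>M) < e\<^sup>2"
      using Cauchy[OF zero_less_power[OF \<open>e > 0\<close>]] by blast
    have "(\<integral>x. cmod (s i x - s j x) \<partial>M) < e" if "i \<ge> N" "j \<ge> N" for i j
      using N that expectation_cmod_power2_le[OF L2_diff[OF s s], of i j] \<open>e > 0\<close>
      by (intro power2_less_imp_less[of _ e]) (auto intro: le_less_trans)
    then show ?thesis by blast
  qed
  from cauchy_L1_AE_cauchy_subseq[OF L2_imp_integrable[OF s] this]
  obtain r where r: "strict_mono r" and AE: "AE x in M. Cauchy (\<lambda>i. s (r i) x)" by blast
  \<comment> \<open>Where the subsequence diverges, \<open>lim\<close> takes one fixed unspecified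
    value. This keeps \<open>f\<close> measurable and matters only on a null set.\<close>
  define f where "f x = lim (\<lambda>i. s (r i) x)" for x
  have [measurable]: "f \<in> borel_measurable M"
    unfolding f_def by (rule borel_measurable_lim_metric) simp
  have lim: "AE x in M. (\<lambda>i. s (r i) x) \<longlonglongrightarrow> f x"
    using AE by eventually_elim (simp add: f_def Cauchy_convergent_iff convergent_LIMSEQ_iff)
  \<comment> \<open>Fatou's lemma in the second index with \<open>i\<close> fixed;
    \<open>r j \<ge> j\<close> keeps that index beyond \<open>N\<close>.\<close>
  have bound: "(\<integral>\<^sup>+x. ennreal ((cmod (s i x - f x))\<^sup>2) \<partial>M) \<le> ennreal e"
    if N: "\<forall>i\<ge>N. \<forall>j\<ge>N. (\<integral>x. (cmod (s i x - s j x))\<^sup>2 \<partial>M) < e" and "i \<ge> N" for i N e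
  proof -
    have "(\<integral>\<^sup>+x. ennreal ((cmod (s i x - f x))\<^sup>2) \<partial>M)
        = (\<integral>\<^sup>+x. liminf (\<lambda>j. ennreal ((cmod (s i x - s (r j) x))\<^sup>2)) \<partial>M)"
    proof (rule nn_integral_cong_AE, use lim in eventually_elim)
      case (elim x)
      have "(\<lambda>j. ennreal ((cmod (s i x - s (r j) x))\<^sup>2)) \<longlonglongrightarrow> ennreal ((cmod (s i x - f x))\<^sup>2)"
        by (intro tendsto_ennrealI tendsto_intros elim)
      then show ?case by (intro lim_imp_Liminf[symmetric]) simp_all
    qed
    also have "\<dots> \<le> liminf (\<lambda>j. \<integral>\<^sup>+x. ennreal ((cmod (s i x - s (r j) x))\<^sup>2) \<partial>M)"
      by (rule nn_integral_liminf) measurable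
    also have "\<dots> \<le> ennreal e"
    proof (rule Liminf_le)
      show "\<forall>\<^sub>F j in sequentially. (\<integral>\<^sup>+x. ennreal ((cmod (s i x - s (r j) x))\<^sup>2) \<partial>M) \<le> ennreal e"
        using eventually_ge_at_top[of N]
      proof eventually_elim
        case (elim j)
        then have "r j \<ge> N" using seq_suble[OF r, of j] by linarith
        then have "(\<integral>x. (cmod (s i x - s (r j) x))\<^sup>2 \<partial>M) \<le> e" using N \<open>i \<ge> N\<close> by (simp add: less_imp_le)
        then show ?case
          by (subst nn_integral_eq_integral) (auto intro!: ennreal_leI L2_integrable L2_diff s)
      qed
    qed simp
    finally show ?thesis .
  qed
  have L2_if_bound: "(\<lambda>x. s i x - f x) \<in> L2 M"
    if "(\<integral>\<^sup>+x. ennreal ((cmod (s i x - f x))\<^sup>2) \<partial>M) \<le> ennreal e" for i e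
  proof -
    have "integrable M (\<lambda>x. (cmod (s i x - f x))\<^sup>2)"
      using that by (intro integrableI_bounded) (auto simp: top_unique less_top[symmetric])
    then show ?thesis by (simp add: L2_def)
  qed
  obtain N where "\<forall>i\<ge>N. \<forall>j\<ge>N. (\<integral>x. (cmod (s i x - s j x))\<^sup>2 \<partial>M) < 1"
    using Cauchy[of 1] by auto
  from L2_if_bound[OF bound[OF this order_refl]] have "f \<in> L2 M"
    using L2_diff[OF s[of N], of "\<lambda>x. s N x - f x"] by simp
  moreover have "(\<lambda>i. \<integral>x. (cmod (s i x - f x))\<^sup>2 \<partial>M) \<longlonglongrightarrow> 0"
  proof (rule LIMSEQ_I)
    fix e :: real assume "e > 0"
    \<comment> \<open>Fatou's lemma leaves only a non-strict bound, hence the half of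
      \<open>e\<close>.\<close>
    then obtain N where N: "\<forall>i\<ge>N. \<forall>j\<ge>N. (\<integral>x. (cmod (s i x - s j x))\<^sup>2 \<partial>M) < e / 2"
      using Cauchy[of "e / 2"] by auto
    have "(\<integral>x. (cmod (s i x - f x))\<^sup>2 \<partial>M) \<le> e / 2" if "i \<ge> N" for i
      using bound[OF N that] L2_integrable[OF L2_diff[OF s \<open>f \<in> L2 M\<close>], of i] \<open>e > 0\<close>
      by (subst (asm) nn_integral_eq_integral) auto
    then have "\<forall>i\<ge>N. norm ((\<integral>x. (cmod (s i x - f x))\<^sup>2 \<partial>M) - 0) < e"
      using \<open>e > 0\<close> by (fastforce simp: integral_nonneg)
    then show "\<exists>N. \<forall>i\<ge>N. norm ((\<integral>x. (cmod (s i x - f x))\<^sup>2 \<partial>M) - 0) < e" ..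
  qed
  ultimately show ?thesis ..
qed

section \<open>Approximation in L2 and separability\<close>

definition L2_closure :: "('a \<Rightarrow> complex) set \<Rightarrow> ('a \<Rightarrow> complex) set" where
  "L2_closure D = {f \<in> L2 M. \<forall>e>0. \<exists>d\<in>D. (\<integral>x. (cmod (f x - d x))\<^sup>2 \<partial>M) < e}"

lemma L2_closure_zero:
  assumes "(\<lambda>_. 0) \<in> D"
  shows "(\<lambda>_. 0) \<in> L2_closure D"
  unfolding L2_closure_def
  by (intro CollectI conjI allI impI L2_zero) (rule bexI[OF _ assms], simp)

lemma L2_closure_add:
  assumes D: "D \<subseteq> L2 M" "\<And>d d'. d \<in> D \<Longrightarrow> d' \<in> D \<Longrightarrow> (\<lambda>x. d x + d' x) \<in> D"
    and f: "f \<in> L2_closure D" and g: "g \<in> L2_closure D"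
  shows "(\<lambda>x. f x + g x) \<in> L2_closure D"
  unfolding L2_closure_def
proof (intro CollectI conjI allI impI)
  have L2: "f \<in> L2 M" "g \<in> L2 M" using f g by (auto simp: L2_closure_def)
  then show "(\<lambda>x. f x + g x) \<in> L2 M" by simp
  fix e :: real assume "e > 0"
  \<comment> \<open>The distances are squared, and \<open>norm_add_power2_le\<close> doubles both
    errors: 2 * (e / 4) + 2 * (e / 4) = e.\<close>
  then have "e / 4 > 0" by simp
  obtain d where d: "d \<in> D" "(\<integral>x. (cmod (f x - d x))\<^sup>2 \<partial>M) < e / 4"
    using f \<open>e / 4 > 0\<close> unfolding L2_closure_def by blast
  obtain d' where d': "d' \<in> D" "(\<integral>x. (cmod (g x - d' x))\<^sup>2 \<partial>M) < e / 4"
    using g \<open>e / 4 > 0\<close> unfolding L2_closure_def by blast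
  have dL2: "d \<in> L2 M" "d' \<in> L2 M" using d d' D by auto
  have "(\<integral>x. (cmod (f x + g x - (d x + d' x)))\<^sup>2 \<partial>M)
      \<le> (\<integral>x. 2 * (cmod (f x - d x))\<^sup>2 + 2 * (cmod (g x - d' x))\<^sup>2 \<partial>M)"
  proof (rule integral_mono)
    show "(cmod (f x + g x - (d x + d' x)))\<^sup>2 \<le> 2 * (cmod (f x - d x))\<^sup>2 + 2 * (cmod (g x - d' x))\<^sup>2"
      for x using norm_add_power2_le[of "f x - d x" "g x - d' x"] by (simp add: algebra_simps)
  qed (use L2 dL2 in \<open>auto intro!: L2_integrable Bochner_Integration.integrable_add\<close>)
  also have "\<dots> = 2 * (\<integral>x. (cmod (f x - d x))\<^sup>2 \<partial>M) + 2 * (\<integral>x. (cmod (g x - d' x))\<^sup>2 \<partial>M)"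
    using L2 dL2 by (subst Bochner_Integration.integral_add) (auto intro!: L2_integrable)
  also have "\<dots> < e" using d d' by simp
  finally show "\<exists>d\<in>D. (\<integral>x. (cmod (f x + g x - d x))\<^sup>2 \<partial>M) < e"
    using D(2)[OF d(1) d'(1)] by (intro bexI[of _ "\<lambda>x. d x + d' x"])
qed

lemma L2_closure_sum:
  assumes D: "D \<subseteq> L2 M" "\<And>d d'. d \<in> D \<Longrightarrow> d' \<in> D \<Longrightarrow> (\<lambda>x. d x + d' x) \<in> D" "(\<lambda>_. 0) \<in> D"
    and f: "\<And>i. i \<in> I \<Longrightarrow> f i \<in> L2_closure D"
  shows "(\<lambda>x. \<Sum>i\<in>I. f i x) \<in> L2_closure D"
  using f
proof (induction I rule: infinite_finite_induct)
  case (insert i I)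
  have "f i \<in> L2_closure D" "(\<lambda>x. \<Sum>i\<in>I. f i x) \<in> L2_closure D"
    by (intro insert.prems insert.IH; simp)+
  then have "(\<lambda>x. f i x + (\<Sum>i\<in>I. f i x)) \<in> L2_closure D"
    by (intro L2_closure_add[of D "f i" "\<lambda>x. \<Sum>i\<in>I. f i x"] D(1)) (rule D(2))
  then show ?case unfolding sum.insert[OF insert.hyps] .
qed (use L2_closure_zero[OF D(3)] in simp_all)

text \<open>Dominated convergence, followed by one approximation of a late term from
  \<open>D\<close>. The factor 2 in the domination is the one that
  \<open>borel_measurable_implies_sequence_metric\<close> provides for simple approximants.\<close>

lemma L2_closure_lim:
  assumes D: "D \<subseteq> L2 M" and f: "f \<in> L2 M" and s: "\<And>i::nat. s i \<in> L2_closure D"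
    and lim: "\<And>x. x \<in> space M \<Longrightarrow> (\<lambda>i. s i x) \<longlonglongrightarrow> f x"
    and bound: "\<And>i x. x \<in> space M \<Longrightarrow> cmod (s i x) \<le> 2 * cmod (f x)"
  shows "f \<in> L2_closure D"
  unfolding L2_closure_def
proof (intro CollectI conjI allI impI f)
  fix e :: real assume "e > 0"
  have sL2: "s i \<in> L2 M" for i using s by (auto simp: L2_closure_def)
  have [measurable]: "f \<in> borel_measurable M" "\<And>i. s i \<in> borel_measurable M"
    using f sL2 by (auto intro: L2_measurable)
  have "(\<lambda>i. \<integral>x. (cmod (f x - s i x))\<^sup>2 \<partial>M) \<longlonglongrightarrow> (\<integral>x. 0 \<partial>M)"
  proof (rule integral_dominated_convergence)
    \<comment> \<open>The constant is 10 = 2 + 2 * 2^2: \<open>norm_diff_power2_le\<close> combined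
      with the factor 2 of the domination.\<close>
    show "integrable M (\<lambda>x. 10 * (cmod (f x))\<^sup>2)" using L2_integrable[OF f] by simp
    show "AE x in M. (\<lambda>i. (cmod (f x - s i x))\<^sup>2) \<longlonglongrightarrow> 0"
    proof (rule AE_I2)
      fix x assume "x \<in> space M"
      from tendsto_diff[OF tendsto_const lim[OF this], of "f x"]
      have "(\<lambda>i. f x - s i x) \<longlonglongrightarrow> 0" by simp
      from tendsto_power[OF tendsto_norm[OF this], of 2]
      show "(\<lambda>i. (cmod (f x - s i x))\<^sup>2) \<longlonglongrightarrow> 0" by simp
    qed
    show "AE x in M. norm ((cmod (f x - s i x))\<^sup>2) \<le> 10 * (cmod (f x))\<^sup>2" for i
    proof (rule AE_I2)
      fix x assume "x \<in> space M"
      show "norm ((cmod (f x - s i x))\<^sup>2) \<le> 10 * (cmod (f x))\<^sup>2"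
        using norm_diff_power2_le[of "f x" "s i x"] power_mono[OF bound[OF \<open>x \<in> space M\<close>], of i 2]
        by (simp add: power_mult_distrib)
    qed
  qed measurable
  then have "\<forall>\<^sub>F i in sequentially. (\<integral>x. (cmod (f x - s i x))\<^sup>2 \<partial>M) < e / 4"
    using \<open>e > 0\<close> by (intro order_tendstoD) auto
  then obtain i where i: "(\<integral>x. (cmod (f x - s i x))\<^sup>2 \<partial>M) < e / 4"
    using eventually_happens'[OF sequentially_bot] by blast
  have "e / 4 > 0" using \<open>e > 0\<close> by simp
  then obtain d where d: "d \<in> D" "(\<integral>x. (cmod (s i x - d x))\<^sup>2 \<partial>M) < e / 4"
    using s[of i] unfolding L2_closure_def by blast
  have dL2: "d \<in> L2 M" using d D by auto
  have "(\<integral>x. (cmod (f x - d x))\<^sup>2 \<partial>M)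
      \<le> (\<integral>x. 2 * (cmod (f x - s i x))\<^sup>2 + 2 * (cmod (s i x - d x))\<^sup>2 \<partial>M)"
  proof (rule integral_mono)
    show "(cmod (f x - d x))\<^sup>2 \<le> 2 * (cmod (f x - s i x))\<^sup>2 + 2 * (cmod (s i x - d x))\<^sup>2"
      for x using norm_add_power2_le[of "f x - s i x" "s i x - d x"] by simp
  qed (use f sL2 dL2 in \<open>auto intro!: L2_integrable Bochner_Integration.integrable_add\<close>)
  also have "\<dots> = 2 * (\<integral>x. (cmod (f x - s i x))\<^sup>2 \<partial>M) + 2 * (\<integral>x. (cmod (s i x - d x))\<^sup>2 \<partial>M)"
    using f sL2 dL2 by (subst Bochner_Integration.integral_add) (auto intro!: L2_integrable)
  also have "\<dots> < e" using d i by simp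
  finally show "\<exists>d\<in>D. (\<integral>x. (cmod (f x - d x))\<^sup>2 \<partial>M) < e" using d(1) by blast
qed

end

text \<open>The dense set consists of the finite combinations of indicators of generators with
  coefficients from a countable dense set of complex numbers. Its closure absorbs in turn arbitrary
  coefficients, arbitrary measurable sets (Dynkin's theorem), simple functions and finally all of
  L2.\<close>

lemma (in prob_space) L2_separable:
  assumes G: "countable G" "G \<subseteq> Pow (space M)" "Int_stable G" "space M \<in> G"
    "sets M = sigma_sets (space M) G"
  obtains D where "countable D" "D \<subseteq> L2 M" "L2_closure D = L2 M"
proof -
  obtain Q :: "complex set" where Q: "countable Q" "\<And>W. open W \<Longrightarrow> W \<noteq> {} \<Longrightarrow> \<exists>q\<in>Q. q \<in> W"
    using countable_dense_setE by metis
  \<comment> \<open>Lists of pairs as codes: countability is immediate, and concatenation of codes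
    is addition of functions.\<close>
  define F :: "(complex \<times> 'a set) list \<Rightarrow> 'a \<Rightarrow> complex"
    where "F l x = (\<Sum>(q, A)\<leftarrow>l. q * indicator A x)" for l x
  define D where "D = F ` lists (Q \<times> G)"
  have GM: "A \<in> sets M" if "A \<in> G" for A using that G(5) by auto
  have indL2: "(\<lambda>x. c * indicator A x) \<in> L2 M" if "A \<in> sets M" for c :: complex and A
    using that by (intro L2_bounded[of _ "cmod c"]) (auto simp: indicator_def)
  have D_L2: "D \<subseteq> L2 M"
  proof -
    have "F l \<in> L2 M" if "l \<in> lists (Q \<times> G)" for l
      using that
    proof (induction l)
      case Nil
      show ?case by (simp add: F_def[abs_def])
    next
      case (Cons a l)
      obtain q A where a: "a = (q, A)" by (cases a)
      have "F (a # l) = (\<lambda>x. q * indicator A x + F l x)" by (auto simp: F_def a)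
      then show ?case using Cons by (auto intro!: L2_add indL2 GM simp: a)
    qed
    then show ?thesis by (auto simp: D_def)
  qed
  have D_add: "(\<lambda>x. d x + d' x) \<in> D" if dD: "d \<in> D" "d' \<in> D" for d d'
  proof -
    obtain l l' where l: "l \<in> lists (Q \<times> G)" "d = F l" "l' \<in> lists (Q \<times> G)" "d' = F l'"
      using dD unfolding D_def by blast
    then have "(\<lambda>x. d x + d' x) = F (l @ l')" by (auto simp: F_def)
    moreover have "l @ l' \<in> lists (Q \<times> G)" using l by auto
    ultimately show ?thesis unfolding D_def by (rule image_eqI)
  qed
  have D_zero: "(\<lambda>_. 0) \<in> D"
    unfolding D_def by (rule image_eqI[of _ _ "[]"]) (auto simp: F_def)
  have generator: "(\<lambda>x. c * indicator A x) \<in> L2_closure D" if "A \<in> G" for A c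
    unfolding L2_closure_def
  proof (intro CollectI conjI allI impI indL2 GM that)
    fix e :: real assume "e > 0"
    then have "ball c (sqrt e) \<noteq> {}" by simp
    then obtain q where q: "q \<in> Q" "cmod (c - q) < sqrt e"
      using Q(2)[of "ball c (sqrt e)"] by (auto simp: dist_norm)
    have "(\<integral>x. (cmod (c * indicator A x - q * indicator A x))\<^sup>2 \<partial>M) \<le> (\<integral>x. (cmod (c - q))\<^sup>2 \<partial>M)"
    proof (rule integral_mono)
      show "integrable M (\<lambda>x. (cmod (c * indicator A x - q * indicator A x))\<^sup>2)"
        by (intro L2_integrable L2_diff indL2 GM that)
    qed (auto simp: indicator_def)
    also have "\<dots> = (cmod (c - q))\<^sup>2" by (simp add: prob_space)
    also have "\<dots> < (sqrt e)\<^sup>2" using q(2) by (intro power_strict_mono) auto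
    also have "\<dots> = e" using \<open>e > 0\<close> by simp
    finally have "(\<integral>x. (cmod (c * indicator A x - F [(q, A)] x))\<^sup>2 \<partial>M) < e" by (simp add: F_def)
    moreover have "F [(q, A)] \<in> D" using q that unfolding D_def by (intro imageI) auto
    ultimately show "\<exists>d\<in>D. (\<integral>x. (cmod (c * indicator A x - d x))\<^sup>2 \<partial>M) < e" by blast
  qed
  \<comment> \<open>The coefficient stays arbitrary in the induction because the complement step
    uses the hypothesis for \<open>- c\<close>; that step also takes the indicator of the whole
    space from \<open>G\<close>.\<close>
  have ind: "(\<lambda>x. c * indicator A x) \<in> L2_closure D" if "A \<in> sets M" for A c
    using G(3,2) that unfolding G(5)
  proof (induction arbitrary: c rule: sigma_sets_induct_disjoint)
    case (basic A)
    then show ?case by (rule generator)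
  next
    case empty
    show ?case using L2_closure_zero[OF D_zero] by simp
  next
    case (compl A)
    have "(\<lambda>x. c * indicator (space M) x + (- c) * indicator A x) \<in> L2_closure D"
      by (intro L2_closure_add D_L2 D_add generator G(4) compl.IH)
    also have "(\<lambda>x. c * indicator (space M) x + (- c) * indicator A x)
        = (\<lambda>x. c * indicator (space M - A) x)"
      using sets.sets_into_space[of A M] compl.hyps G(5) by (auto simp: indicator_def fun_eq_iff)
    finally show ?case .
  next
    case (union A)
    have A: "A i \<in> sets M" for i using union.hyps(2) G(5) by auto
    show ?case
    proof (rule L2_closure_lim[OF D_L2])
      show "(\<lambda>x. c * indicator (\<Union>i. A i) x) \<in> L2 M" using A by (intro indL2) auto
      show "(\<lambda>x. \<Sum>i<m. c * indicator (A i) x) \<in> L2_closure D" for m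
        by (intro L2_closure_sum D_L2 D_add D_zero union.IH)
      \<comment> \<open>By disjointness a partial sum is a multiple of the indicator of a partial
        union, which yields both the pointwise limit and the domination.\<close>
      have partial: "(\<Sum>i<m. c * indicator (A i) x) = c * indicator (\<Union>i<m. A i) x" for m x
        by (subst indicator_UN_disjoint)
          (auto simp: sum_distrib_left disjoint_family_on_mono[OF subset_UNIV union.hyps(1)])
      show "(\<lambda>m. \<Sum>i<m. c * indicator (A i) x) \<longlonglongrightarrow> c * indicator (\<Union>i. A i) x" for x
        unfolding partial by (intro tendsto_mult tendsto_const LIMSEQ_indicator_UN)
      show "cmod (\<Sum>i<m. c * indicator (A i) x) \<le> 2 * cmod (c * indicator (\<Union>i. A i) x)" for m x
        unfolding partial by (auto simp: indicator_def)
    qed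
  qed
  have simple: "s \<in> L2_closure D" if "simple_function M s" for s
  proof -
    have fin: "finite (s ` space M)" and meas: "\<And>y. s -` {y} \<inter> space M \<in> sets M"
      using simple_functionD[OF that] by auto
    have cl: "(\<lambda>x. \<Sum>y\<in>s ` space M. y * indicator (s -` {y} \<inter> space M) x) \<in> L2_closure D"
      by (intro L2_closure_sum D_L2 D_add D_zero ind meas)
    have s_eq: "(\<Sum>y\<in>s ` space M. y * indicator (s -` {y} \<inter> space M) x) = s x" if "x \<in> space M" for x
    proof -
      have "(\<Sum>y\<in>s ` space M. y * indicator (s -` {y} \<inter> space M) x)
          = (\<Sum>y\<in>s ` space M. if y = s x then s x else 0)"
        using that by (intro sum.cong) (auto simp: indicator_def)
      then show ?thesis using that fin by simp
    qed
    show ?thesis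
    \<comment> \<open>The finite sum agrees with \<open>s\<close> only on \<open>space M\<close>, so
      \<open>s\<close> is taken as the limit of the constant sequence with that sum as its
      value.\<close>
    proof (rule L2_closure_lim[OF D_L2 _ cl])
      show "s \<in> L2 M"
      proof (rule L2_bounded)
        show "s \<in> borel_measurable M" using that by (rule borel_measurable_simple_function)
        show "cmod (s x) \<le> Max (cmod ` s ` space M)" if "x \<in> space M" for x
          using that fin by (intro Max_ge) auto
      qed
    qed (simp_all add: s_eq)
  qed
  have "f \<in> L2_closure D" if f: "f \<in> L2 M" for f
  proof -
    obtain s where "\<And>i. simple_function M (s i)"
      "\<And>x. x \<in> space M \<Longrightarrow> (\<lambda>i. s i x) \<longlonglongrightarrow> f x"
      "\<And>i x. x \<in> space M \<Longrightarrow> dist (s i x) 0 \<le> 2 * dist (f x) 0"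
      using borel_measurable_implies_sequence_metric[OF L2_measurable[OF f], of 0] by blast
    then show ?thesis by (intro L2_closure_lim[OF D_L2 f, of s] simple) auto
  qed
  then have "L2_closure D = L2 M" by (auto simp: L2_closure_def)
  moreover have "countable D" unfolding D_def using Q(1) G(1) by (intro countable_image countable_lists) auto
  ultimately show ?thesis using that D_L2 by blast
qed

text \<open>Finite intersections of a countable basis remain countable in number and are stable
  under intersection, as Dynkin's theorem demands; the empty intersection contributes
  \<open>UNIV\<close>.\<close>

lemma countable_Int_stable_generator_borel:
  obtains G :: "'a::second_countable_topology set set"
  where "countable G" "Int_stable G" "UNIV \<in> G" "sets borel = sigma_sets UNIV G"
proof -
  obtain B :: "'a set set" where B: "countable B" "topological_basis B"
    using ex_countable_basis by blast
  define G where "G = Inter ` {F. finite F \<and> F \<subseteq> B}"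
  have "countable G"
    unfolding G_def by (intro countable_image countable_Collect_finite_subset B)
  moreover have "Int_stable G"
  proof (rule Int_stableI)
    fix a b assume "a \<in> G" "b \<in> G"
    then obtain F F' where F: "finite F" "F \<subseteq> B" "a = \<Inter>F" "finite F'" "F' \<subseteq> B" "b = \<Inter>F'"
      unfolding G_def by blast
    then have "a \<inter> b = \<Inter>(F \<union> F')" by auto
    then show "a \<inter> b \<in> G" unfolding G_def using F by (intro image_eqI[of _ _ "F \<union> F'"]) auto
  qed
  moreover have "UNIV \<in> G" unfolding G_def by (rule image_eqI[of _ _ "{}"]) auto
  moreover have "sets borel = sigma_sets UNIV G"
  proof (rule antisym)
    have "B \<subseteq> G" unfolding G_def by (auto intro!: image_eqI[of _ _ "{_}"])
    then show "sets borel \<subseteq> sigma_sets UNIV G"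
      unfolding borel_eq_countable_basis[OF B] by (simp add: sigma_sets_subseteq)
    have "open W" if "W \<in> G" for W
      using that topological_basis_open[OF B(2)] by (auto simp: G_def intro!: open_Inter)
    then have "G \<subseteq> sets borel" by auto
    then show "sigma_sets UNIV G \<subseteq> sets borel"
      using sets.sigma_sets_subset[of G borel] by simp
  qed
  ultimately show ?thesis ..
qed

section \<open>The Hilbert space of classes of square-integrable functions\<close>

text \<open>
  A representative chosen in each class, so that almost everywhere equality becomes equality.
\<close>

definition L2_rep :: "'a measure \<Rightarrow> ('a \<Rightarrow> complex) \<Rightarrow> 'a \<Rightarrow> complex" where
  "L2_rep M f = (SOME g. g \<in> L2 M \<and> (AE x in M. g x = f x))"

lemma L2_rep:
  assumes "f \<in> L2 M"
  shows L2_rep_in_L2: "L2_rep M f \<in> L2 M" and L2_rep_AE: "AE x in M. L2_rep M f x = f x"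
  using someI[of "\<lambda>g. g \<in> L2 M \<and> (AE x in M. g x = f x)" f] assms by (auto simp: L2_rep_def)

text \<open>The conditions under \<open>SOME\<close> are equal as predicates, so the same
  representative is chosen.\<close>

lemma L2_rep_cong:
  assumes "AE x in M. f x = g x"
  shows "L2_rep M f = L2_rep M g"
proof -
  have "(AE x in M. h x = f x) \<longleftrightarrow> (AE x in M. h x = g x)" for h
    by (rule eventually_cong[OF assms]) auto
  then show ?thesis by (simp add: L2_rep_def)
qed

lemma L2_rep_eq_iff:
  assumes "f \<in> L2 M" "g \<in> L2 M"
  shows "L2_rep M f = L2_rep M g \<longleftrightarrow> (AE x in M. f x = g x)"
proof
  assume eq: "L2_rep M f = L2_rep M g"
  show "AE x in M. f x = g x"
    using L2_rep_AE[OF assms(1)] L2_rep_AE[OF assms(2)] by eventually_elim (simp add: eq)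
qed (rule L2_rep_cong)

text \<open>Sums and multiples are sent back to the chosen representative, so that the module axioms
  hold as equations between functions. The integral in \<open>ip\<close> ignores null sets and needs
  no such correction.\<close>

definition L2_space :: "'a measure \<Rightarrow> ('a \<Rightarrow> complex) inner_module" where
  "L2_space M = \<lparr>carrier = L2_rep M ` L2 M, monoid.mult = \<lambda>_ _. undefined, one = undefined,
     ring.zero = L2_rep M (\<lambda>_. 0), add = \<lambda>f g. L2_rep M (\<lambda>x. f x + g x),
     smult = \<lambda>c f. L2_rep M (\<lambda>x. c * f x), ip = \<lambda>f g. \<integral>x. f x * cnj (g x) \<partial>M\<rparr>"

lemma L2_space_carrier: "carrier (L2_space M) = L2_rep M ` L2 M"
  and L2_space_zero: "\<zero>\<^bsub>L2_space M\<^esub> = L2_rep M (\<lambda>_. 0)"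
  by (simp_all add: L2_space_def)

lemma L2_rep_carrier [simp]: "f \<in> L2 M \<Longrightarrow> L2_rep M f \<in> carrier (L2_space M)"
  by (simp add: L2_space_carrier)

lemma L2_space_add:
  assumes "f \<in> L2 M" "g \<in> L2 M"
  shows "L2_rep M f \<oplus>\<^bsub>L2_space M\<^esub> L2_rep M g = L2_rep M (\<lambda>x. f x + g x)"
proof -
  have "L2_rep M (\<lambda>x. L2_rep M f x + L2_rep M g x) = L2_rep M (\<lambda>x. f x + g x)"
    by (rule L2_rep_cong, use L2_rep_AE[OF assms(1)] L2_rep_AE[OF assms(2)] in eventually_elim) simp
  then show ?thesis by (simp add: L2_space_def)
qed

lemma L2_space_smult:
  assumes "f \<in> L2 M"
  shows "c \<odot>\<^bsub>L2_space M\<^esub> L2_rep M f = L2_rep M (\<lambda>x. c * f x)"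
proof -
  have "L2_rep M (\<lambda>x. c * L2_rep M f x) = L2_rep M (\<lambda>x. c * f x)"
    by (rule L2_rep_cong, use L2_rep_AE[OF assms] in eventually_elim) simp
  then show ?thesis by (simp add: L2_space_def)
qed

lemma L2_space_ip:
  assumes "f \<in> L2 M" "g \<in> L2 M"
  shows "ip (L2_space M) (L2_rep M f) (L2_rep M g) = (\<integral>x. f x * cnj (g x) \<partial>M)"
proof -
  have "(\<integral>x. L2_rep M f x * cnj (L2_rep M g x) \<partial>M) = (\<integral>x. f x * cnj (g x) \<partial>M)"
  proof (rule integral_cong_AE)
    show "AE x in M. L2_rep M f x * cnj (L2_rep M g x) = f x * cnj (g x)"
      using L2_rep_AE[OF assms(1)] L2_rep_AE[OF assms(2)] by eventually_elim simp
  qed (intro borel_measurable_integrable L2_mult_cnj_integrable L2_rep_in_L2 assms)+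
  then show ?thesis by (simp add: L2_space_def)
qed

lemma L2_space_ip_self:
  assumes "f \<in> L2 M"
  shows "ip (L2_space M) (L2_rep M f) (L2_rep M f) = of_real (\<integral>x. (cmod (f x))\<^sup>2 \<partial>M)"
proof -
  have "f x * cnj (f x) = of_real ((cmod (f x))\<^sup>2)" for x
    by (rule complex_norm_square[symmetric])
  then show ?thesis using assms by (simp only: L2_space_ip integral_complex_of_real)
qed

lemma L2_space_hnorm:
  "f \<in> L2 M \<Longrightarrow> hnorm (L2_space M) (L2_rep M f) = sqrt (\<integral>x. (cmod (f x))\<^sup>2 \<partial>M)"
  by (simp add: hnorm_def L2_space_ip_self)

lemma L2_space_abelian_group: "abelian_group (L2_space M)"
proof (rule abelian_groupI)
  show "\<exists>y\<in>carrier (L2_space M). y \<oplus>\<^bsub>L2_space M\<^esub> x = \<zero>\<^bsub>L2_space M\<^esub>"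
    if x: "x \<in> carrier (L2_space M)" for x
  proof -
    obtain f where f: "f \<in> L2 M" "x = L2_rep M f" using x by (auto simp: L2_space_carrier)
    have f': "(\<lambda>x. - f x) \<in> L2 M" using L2_cmult[OF f(1), of "- 1"] by simp
    show ?thesis
      using f f' by (intro bexI[of _ "L2_rep M (\<lambda>x. - f x)"]) (simp_all add: L2_space_add L2_space_zero)
  qed
qed (auto simp: L2_space_carrier L2_space_zero L2_space_add add_ac)

lemma L2_space_inner: "complex_inner_space (L2_space M)"
proof -
  interpret abelian_group "L2_space M" by (rule L2_space_abelian_group)
  interpret R: cring "ring_of_type_algebra :: complex ring" by (rule cring_from_type_algebra)
  show ?thesis
  proof (unfold_locales, goal_cases)
    case (6 x y z)
    then obtain f g h where "f \<in> L2 M" "x = L2_rep M f" "g \<in> L2 M" "y = L2_rep M g"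
      "h \<in> L2 M" "z = L2_rep M h" by (auto simp: L2_space_carrier)
    then show ?case
      using L2_mult_cnj_integrable[of f M h] L2_mult_cnj_integrable[of g M h]
      by (simp add: L2_space_add L2_space_ip distrib_right)
  next
    case (8 x y)
    then obtain f g where "f \<in> L2 M" "x = L2_rep M f" "g \<in> L2 M" "y = L2_rep M g"
      by (auto simp: L2_space_carrier)
    moreover have "(\<integral>x. g x * cnj (f x) \<partial>M) = (\<integral>x. cnj (f x * cnj (g x)) \<partial>M)"
      by (intro Bochner_Integration.integral_cong) (simp_all add: mult.commute)
    ultimately show ?case by (simp only: L2_space_ip Bochner_Integration.integral_cnj)
  next
    case (9 x)
    then show ?case by (auto simp: L2_space_carrier L2_space_ip_self)
  next
    case (10 x)
    then obtain f where f: "f \<in> L2 M" "x = L2_rep M f" by (auto simp: L2_space_carrier)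
    then have "(\<integral>x. (cmod (f x))\<^sup>2 \<partial>M) = 0" using 10(2) by (simp add: L2_space_ip_self)
    then have "AE x in M. f x = 0"
      using integral_nonneg_eq_0_iff_AE[OF L2_integrable[OF f(1)]] by simp
    then show ?case unfolding f(2) L2_space_zero by (rule L2_rep_cong)
  qed (auto simp: L2_space_carrier L2_space_add L2_space_smult L2_space_ip
        ring_of_type_algebra_def algebra_simps)
qed

lemma L2_space_hdist:
  assumes "f \<in> L2 M" "g \<in> L2 M"
  shows "L2_rep M f \<ominus>\<^bsub>L2_space M\<^esub> L2_rep M g = L2_rep M (\<lambda>x. f x - g x)"
    and "hdist (L2_space M) (L2_rep M f) (L2_rep M g) = sqrt (\<integral>x. (cmod (f x - g x))\<^sup>2 \<partial>M)"
proof -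
  interpret complex_inner_space "L2_space M" by (rule L2_space_inner)
  have g': "(\<lambda>x. - g x) \<in> L2 M" using L2_cmult[OF assms(2), of "- 1"] by simp
  have "\<ominus>\<^bsub>L2_space M\<^esub> L2_rep M g = L2_rep M (\<lambda>x. - g x)"
    using assms g' by (intro M.minus_equality) (simp_all add: L2_space_add L2_space_zero)
  then show diff: "L2_rep M f \<ominus>\<^bsub>L2_space M\<^esub> L2_rep M g = L2_rep M (\<lambda>x. f x - g x)"
    using assms g' by (simp add: M.minus_eq L2_space_add)
  show "hdist (L2_space M) (L2_rep M f) (L2_rep M g) = sqrt (\<integral>x. (cmod (f x - g x))\<^sup>2 \<partial>M)"
    using assms by (simp add: hdist_def diff L2_space_hnorm)
qed

text \<open>Completeness is \<open>L2_Cauchy_limit\<close> applied to lifts of the classes. Second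
  countability enters through the countable generator that \<open>L2_separable\<close>
  requires.\<close>

lemma L2_space_hilbert:
  fixes M :: "'a::second_countable_topology measure"
  assumes "prob_space M" and sets: "sets M = sets borel"
  shows "separable_hilbert_space (L2_space M)"
proof -
  interpret prob_space M by fact
  interpret complex_inner_space "L2_space M" by (rule L2_space_inner)
  interpret MS: Metric_space "carrier (L2_space M)" "hdist (L2_space M)" by (rule hdist_Metric_space)
  have space: "space M = UNIV" using sets_eq_imp_space_eq[OF sets] by simp
  have "MS.mcomplete"
    unfolding MS.mcomplete_def
  proof (intro allI impI)
    fix s assume s: "MS.MCauchy s"
    then have "range s \<subseteq> carrier (L2_space M)" unfolding MS.MCauchy_def by blast
    then have "\<forall>i. \<exists>f. f \<in> L2 M \<and> s i = L2_rep M f" unfolding L2_space_carrier by blast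
    then obtain t where t: "\<And>i. t i \<in> L2 M" "\<And>i. s i = L2_rep M (t i)" by metis
    have "\<exists>N. \<forall>i\<ge>N. \<forall>j\<ge>N. (\<integral>x. (cmod (t i x - t j x))\<^sup>2 \<partial>M) < e" if "e > 0" for e
    proof -
      have "sqrt e > 0" using that by simp
      then obtain N where "\<forall>i j. N \<le> i \<longrightarrow> N \<le> j \<longrightarrow> hdist (L2_space M) (s i) (s j) < sqrt e"
        using s unfolding MS.MCauchy_def by blast
      then show ?thesis by (auto simp: t L2_space_hdist)
    qed
    with t(1) obtain f where f: "f \<in> L2 M" "(\<lambda>i. \<integral>x. (cmod (t i x - f x))\<^sup>2 \<partial>M) \<longlonglongrightarrow> 0"
      by (rule L2_Cauchy_limit)
    have "limitin MS.mtopology s (L2_rep M f) sequentially"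
      unfolding MS.limitin_metric
    proof (intro conjI allI impI)
      fix e :: real assume "e > 0"
      have "(\<lambda>i. sqrt (\<integral>x. (cmod (t i x - f x))\<^sup>2 \<partial>M)) \<longlonglongrightarrow> 0"
        using tendsto_real_sqrt[OF f(2)] by simp
      then have "\<forall>\<^sub>F i in sequentially. sqrt (\<integral>x. (cmod (t i x - f x))\<^sup>2 \<partial>M) < e"
        using \<open>e > 0\<close> by (intro order_tendstoD)
      then show "\<forall>\<^sub>F i in sequentially. s i \<in> carrier (L2_space M) \<and> hdist (L2_space M) (s i) (L2_rep M f) < e"
        by eventually_elim (simp add: t f L2_space_hdist)
    qed (simp add: f)
    then show "\<exists>l. limitin MS.mtopology s l sequentially" by (rule exI[of _ "L2_rep M f"])
  qed
  moreover have "separable_space MS.mtopology"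
  proof -
    obtain G :: "'a set set" where "countable G" "Int_stable G" "UNIV \<in> G" "sets borel = sigma_sets UNIV G"
      by (rule countable_Int_stable_generator_borel)
    then obtain D where D: "countable D" "D \<subseteq> L2 M" "L2_closure D = L2 M"
      using L2_separable[of G] by (auto simp: space sets)
    have "carrier (L2_space M) \<subseteq> MS.mtopology closure_of (L2_rep M ` D)"
    proof
      fix x assume "x \<in> carrier (L2_space M)"
      then obtain f where f: "f \<in> L2 M" "x = L2_rep M f" by (auto simp: L2_space_carrier)
      have "\<exists>y\<in>L2_rep M ` D. y \<in> MS.mball x r" if "r > 0" for r
      proof -
        have "r\<^sup>2 > 0" using that by simp
        moreover have "f \<in> L2_closure D" using f(1) D(3) by blast
        ultimately obtain d where d: "d \<in> D" "(\<integral>x. (cmod (f x - d x))\<^sup>2 \<partial>M) < r\<^sup>2"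
          unfolding L2_closure_def by blast
        then have "sqrt (\<integral>x. (cmod (f x - d x))\<^sup>2 \<partial>M) < r"
          using \<open>r > 0\<close> by (intro real_less_lsqrt) auto
        then have "L2_rep M d \<in> MS.mball x r"
          using d D(2) f by (auto simp: L2_space_hdist subset_iff)
        then show ?thesis using d by blast
      qed
      then show "x \<in> MS.mtopology closure_of (L2_rep M ` D)"
        unfolding MS.metric_closure_of using f by auto
    qed
    moreover have "L2_rep M ` D \<subseteq> carrier (L2_space M)" using D(2) by (auto simp: subset_iff)
    ultimately show ?thesis
      unfolding separable_space_def MS.topspace_mtopology
      using D(1) closure_of_subset_topspace[of MS.mtopology "L2_rep M ` D"]
      by (intro exI[of _ "L2_rep M ` D"]) auto
  qed
  ultimately show ?thesis by unfold_locales
qed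

section \<open>Multiplication operators\<close>

definition mult_op :: "'a measure \<Rightarrow> ('a \<Rightarrow> complex) \<Rightarrow> ('a \<Rightarrow> complex) \<Rightarrow> 'a \<Rightarrow> complex" where
  "mult_op M \<phi> f = L2_rep M (\<lambda>x. \<phi> x * f x)"

text \<open>The modulus is prescribed only almost everywhere, because the quotient used later is
  unimodular on pairs of circle points but not on the whole of the product of two planes.\<close>

locale unimodular =
  fixes M :: "'a measure" and \<phi> :: "'a \<Rightarrow> complex"
  assumes measurable_phi [measurable]: "\<phi> \<in> borel_measurable M"
    and norm_phi: "AE x in M. cmod (\<phi> x) = 1"
begin

lemma L2_mult [simp]:
  assumes "f \<in> L2 M"
  shows "(\<lambda>x. \<phi> x * f x) \<in> L2 M"
proof (rule L2_bound[OF assms, where C = 1])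
  show "(\<lambda>x. \<phi> x * f x) \<in> borel_measurable M" using L2_measurable[OF assms] by measurable
  show "AE x in M. cmod (\<phi> x * f x) \<le> 1 * cmod (f x)"
    using norm_phi by eventually_elim (simp add: norm_mult)
qed

lemma mult_op_rep:
  assumes "f \<in> L2 M"
  shows "mult_op M \<phi> (L2_rep M f) = L2_rep M (\<lambda>x. \<phi> x * f x)"
  unfolding mult_op_def by (rule L2_rep_cong, use L2_rep_AE[OF assms] in eventually_elim) simp

lemma mult_op_funpow:
  assumes "f \<in> L2 M"
  shows "(mult_op M \<phi> ^^ m) (L2_rep M f) = L2_rep M (\<lambda>x. \<phi> x ^ m * f x)"
    and "(\<lambda>x. \<phi> x ^ m * f x) \<in> L2 M"
proof (induction m)
  case 0
  case 1 then show ?case by simp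
  case 2 then show ?case using assms by simp
next
  case (Suc m)
  case 1 then show ?case using Suc by (simp add: mult_op_rep mult.assoc)
  case 2 then show ?case using L2_mult[OF Suc(2)] by (simp add: mult.assoc)
qed

end

section \<open>Unitarity and integer iterates of multiplication operators\<close>

context unimodular
begin

text \<open>The inverse is again unimodular, so the results on iterates also serve negative
  exponents.\<close>

interpretation inv: unimodular M "\<lambda>x. inverse (\<phi> x)"
proof
  show "AE x in M. cmod (inverse (\<phi> x)) = 1"
    using norm_phi by eventually_elim (simp add: norm_inverse)
qed measurable

lemma mult_op_inverse:
  assumes "x \<in> carrier (L2_space M)"
  shows "mult_op M (\<lambda>x. inverse (\<phi> x)) (mult_op M \<phi> x) = x"
    "mult_op M \<phi> (mult_op M (\<lambda>x. inverse (\<phi> x)) x) = x"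
proof -
  obtain f where f: "f \<in> L2 M" "x = L2_rep M f" using assms by (auto simp: L2_space_carrier)
  have nonzero: "AE x in M. \<phi> x \<noteq> 0" using norm_phi by eventually_elim auto
  have "L2_rep M (\<lambda>x. inverse (\<phi> x) * (\<phi> x * f x)) = L2_rep M f"
    by (rule L2_rep_cong, use nonzero in eventually_elim) simp
  moreover have "L2_rep M (\<lambda>x. \<phi> x * (inverse (\<phi> x) * f x)) = L2_rep M f"
    by (rule L2_rep_cong, use nonzero in eventually_elim) simp
  ultimately show "mult_op M (\<lambda>x. inverse (\<phi> x)) (mult_op M \<phi> x) = x"
    "mult_op M \<phi> (mult_op M (\<lambda>x. inverse (\<phi> x)) x) = x"
    using f by (simp_all add: mult_op_rep inv.mult_op_rep)
qed

lemma mult_op_carrier: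
  "x \<in> carrier (L2_space M) \<Longrightarrow> mult_op M \<phi> x \<in> carrier (L2_space M)"
  "x \<in> carrier (L2_space M) \<Longrightarrow> mult_op M (\<lambda>x. inverse (\<phi> x)) x \<in> carrier (L2_space M)"
  unfolding L2_space_carrier by (auto simp: mult_op_rep inv.mult_op_rep)

lemma mult_op_bij: "bij_betw (mult_op M \<phi>) (carrier (L2_space M)) (carrier (L2_space M))"
  by (rule bij_betw_byWitness[where f' = "mult_op M (\<lambda>x. inverse (\<phi> x))"])
    (auto simp: mult_op_inverse mult_op_carrier)

lemma mult_op_unitary: "unitary_on (L2_space M) (mult_op M \<phi>)"
  unfolding unitary_on_def
proof (intro conjI ballI allI mult_op_bij)
  fix x y assume "x \<in> carrier (L2_space M)" "y \<in> carrier (L2_space M)"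
  then obtain f g where fg: "f \<in> L2 M" "x = L2_rep M f" "g \<in> L2 M" "y = L2_rep M g"
    by (auto simp: L2_space_carrier)
  then show "mult_op M \<phi> (x \<oplus>\<^bsub>L2_space M\<^esub> y) = mult_op M \<phi> x \<oplus>\<^bsub>L2_space M\<^esub> mult_op M \<phi> y"
    by (simp add: mult_op_rep L2_space_add distrib_left)
  have "(\<integral>x. \<phi> x * f x * cnj (\<phi> x * g x) \<partial>M) = (\<integral>x. f x * cnj (g x) \<partial>M)"
  proof (rule integral_cong_AE)
    show "AE x in M. \<phi> x * f x * cnj (\<phi> x * g x) = f x * cnj (g x)"
      using norm_phi
    proof eventually_elim
      case (elim x)
      have "\<phi> x * f x * cnj (\<phi> x * g x) = (\<phi> x * cnj (\<phi> x)) * (f x * cnj (g x))"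
        by (simp add: mult_ac)
      also have "\<phi> x * cnj (\<phi> x) = 1" using elim by (simp add: complex_norm_square[symmetric])
      finally show ?case by simp
    qed
  qed (intro borel_measurable_integrable L2_mult_cnj_integrable L2_mult fg)+
  then show "ip (L2_space M) (mult_op M \<phi> x) (mult_op M \<phi> y) = ip (L2_space M) x y"
    using fg by (simp add: mult_op_rep L2_space_ip)
next
  fix c x assume "x \<in> carrier (L2_space M)"
  then show "mult_op M \<phi> (c \<odot>\<^bsub>L2_space M\<^esub> x) = c \<odot>\<^bsub>L2_space M\<^esub> mult_op M \<phi> x"
    by (auto simp: L2_space_carrier mult_op_rep L2_space_smult mult.left_commute)
qed

lemma mult_op_int_iter:
  assumes "f \<in> L2 M"
  shows "int_iter (L2_space M) (mult_op M \<phi>) n (L2_rep M f) = L2_rep M (\<lambda>x. \<phi> x powi n * f x)"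
    and "(\<lambda>x. \<phi> x powi n * f x) \<in> L2 M"
proof -
  have inv_eq: "inv_into (carrier (L2_space M)) (mult_op M \<phi>) x = mult_op M (\<lambda>x. inverse (\<phi> x)) x"
    if "x \<in> carrier (L2_space M)" for x
    using that mult_op_bij
    by (intro inv_into_f_eq) (auto simp: bij_betw_def mult_op_carrier mult_op_inverse)
  \<comment> \<open>The two operators are known to agree on the carrier only; the explicit form of
    the iterates shows that they stay there.\<close>
  have "(inv_into (carrier (L2_space M)) (mult_op M \<phi>) ^^ m) (L2_rep M f)
      = (mult_op M (\<lambda>x. inverse (\<phi> x)) ^^ m) (L2_rep M f)" for m
    by (induction m) (use assms in \<open>simp_all add: inv_eq inv.mult_op_funpow\<close>)
  then show "int_iter (L2_space M) (mult_op M \<phi>) n (L2_rep M f) = L2_rep M (\<lambda>x. \<phi> x powi n * f x)"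
    using assms by (simp add: int_iter_def power_int_def mult_op_funpow inv.mult_op_funpow)
  show "(\<lambda>x. \<phi> x powi n * f x) \<in> L2 M"
    using mult_op_funpow(2)[OF assms] inv.mult_op_funpow(2)[OF assms]
    by (cases "n \<ge> 0") (simp_all add: power_int_def)
qed

end

text \<open>The constant function 1 is the almost invariant unit vector, with displacement at most
  \<open>\<delta>\<close>. An invariant \<open>f\<close> satisfies
  \<open>\<phi> x * f x = f x\<close> almost everywhere and so vanishes where \<open>\<phi>\<close>
  differs from 1. The Kazhdan pair reaches this space by
  \<open>kazhdan_pair_any_type\<close>.\<close>

lemma kazhdan_pair_unimodular:
  fixes M :: "'a::second_countable_topology measure"
  assumes K: "kazhdan_pair TYPE(nat \<Rightarrow> complex) Q \<epsilon>"
    and M: "prob_space M" "sets M = sets borel"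
    and phi: "unimodular M \<phi>" "AE x in M. \<phi> x \<noteq> 1"
    and bound: "\<And>n. n \<in> Q \<Longrightarrow> (\<integral>x. (cmod (\<phi> x powi n - 1))\<^sup>2 \<partial>M) \<le> \<delta>\<^sup>2" and \<delta>: "0 \<le> \<delta>"
  shows "\<epsilon> \<le> \<delta>"
proof (rule ccontr)
  assume "\<not> \<epsilon> \<le> \<delta>"
  interpret prob_space M by fact
  interpret unimodular M \<phi> by fact
  let ?H = "L2_space M" and ?U = "mult_op M \<phi>"
  define e where "e = L2_rep M (\<lambda>_. 1)"
  have one: "(\<lambda>_. 1) \<in> L2 M" by (simp add: L2_def)
  have "hnorm ?H (int_iter ?H ?U n e \<ominus>\<^bsub>?H\<^esub> e) \<le> \<delta>" if "n \<in> Q" for n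
  proof -
    have "hnorm ?H (int_iter ?H ?U n e \<ominus>\<^bsub>?H\<^esub> e) = sqrt (\<integral>x. (cmod (\<phi> x powi n - 1))\<^sup>2 \<partial>M)"
      using mult_op_int_iter[OF one, of n] one
      by (simp add: e_def L2_space_hdist(1) L2_space_hnorm)
    then show ?thesis using bound[OF that] \<delta> by (simp add: real_le_lsqrt)
  qed
  \<comment> \<open>A supremum preserves only non-strict bounds; strictness comes from
    \<open>\<delta>\<close> being below \<open>\<epsilon>\<close>.\<close>
  then have "(SUP n\<in>Q. ereal (hnorm ?H (int_iter ?H ?U n e \<ominus>\<^bsub>?H\<^esub> e))) \<le> ereal \<delta>"
    by (intro SUP_least) simp
  also have "\<dots> < ereal \<epsilon>" using \<open>\<not> \<epsilon> \<le> \<delta>\<close> by simp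
  finally have "(SUP n\<in>Q. ereal (hnorm ?H (int_iter ?H ?U n e \<ominus>\<^bsub>?H\<^esub> e))) < ereal \<epsilon>" .
  moreover have "e \<in> carrier ?H" "hnorm ?H e = 1"
    using one by (simp_all add: e_def L2_space_hnorm prob_space)
  ultimately obtain y where y: "y \<in> carrier ?H" "y \<noteq> \<zero>\<^bsub>?H\<^esub>" "?U y = y"
    using kazhdan_pair_any_type[OF K, where 'a = "'a \<Rightarrow> complex"] L2_space_hilbert[OF M] mult_op_unitary
    unfolding kazhdan_pair_def by blast
  obtain f where f: "f \<in> L2 M" "y = L2_rep M f" using y(1) by (auto simp: L2_space_carrier)
  have "AE x in M. \<phi> x * f x = f x"
    using y(3) f L2_rep_eq_iff[OF L2_mult[OF f(1)] f(1)] by (simp add: mult_op_rep)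
  then have "AE x in M. f x = 0" using phi(2) by eventually_elim auto
  from L2_rep_cong[OF this] show False using y(2) by (simp add: f(2) L2_space_zero)
qed

section \<open>Averaging sequences that vanish at infinity\<close>

text \<open>Each new sequence is chosen small up to an index \<open>K\<close> from which the sum of
  the earlier ones is below \<open>\<eta>\<close>. Below \<open>K\<close> only the earlier sum may
  contain a large term, from \<open>K\<close> on only the new one, so \<open>C\<close> is paid once
  and each step adds \<open>\<eta>\<close>.\<close>

lemma sum_le_of_small_initial_segments:
  fixes a :: "'e \<Rightarrow> nat \<Rightarrow> real"
  assumes lim: "\<And>e. e \<in> S \<Longrightarrow> a e \<longlonglongrightarrow> 0" and bound: "\<And>e k. e \<in> S \<Longrightarrow> a e k \<le> C" and "0 \<le> C"
    and small: "\<And>K. \<exists>e\<in>S. \<forall>k<K. a e k \<le> \<eta>" and "\<eta> > 0"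
  shows "\<exists>s. (\<forall>i. s i \<in> S) \<and> (\<forall>k. (\<Sum>i<N. a (s i) k) \<le> C + real N * \<eta>)"
proof (induction N)
  case 0
  \<comment> \<open>\<open>s\<close> is a total function, so its values at indices not yet chosen
    must lie in \<open>S\<close> as well.\<close>
  obtain e where "e \<in> S" using small by blast
  then show ?case using \<open>0 \<le> C\<close> by (intro exI[of _ "\<lambda>_. e"]) simp
next
  case (Suc N)
  then obtain s where s: "\<And>i. s i \<in> S" "\<And>k. (\<Sum>i<N. a (s i) k) \<le> C + real N * \<eta>" by blast
  have "(\<lambda>k. \<Sum>i<N. a (s i) k) \<longlonglongrightarrow> (\<Sum>i<N. 0)" by (intro tendsto_sum lim s)
  then have "\<forall>\<^sub>F k in sequentially. (\<Sum>i<N. a (s i) k) < \<eta>"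
    using \<open>\<eta> > 0\<close> by (intro order_tendstoD) auto
  then obtain K where K: "\<And>k. k \<ge> K \<Longrightarrow> (\<Sum>i<N. a (s i) k) < \<eta>"
    by (auto simp: eventually_sequentially)
  obtain e where e: "e \<in> S" "\<forall>k<K. a e k \<le> \<eta>" using small by blast
  have "(\<Sum>i<N. a (s i) k) + a e k \<le> C + real (Suc N) * \<eta>" for k
  proof (cases "k < K")
    case True
    then show ?thesis using s(2)[of k] e by (auto simp: algebra_simps intro: add_mono)
  next
    case False
    have "0 \<le> real N * \<eta>" using \<open>\<eta> > 0\<close> by simp
    then show ?thesis using False K[of k] bound[OF e(1), of k] by (simp add: algebra_simps)
  qed
  then show ?case using s(1) e(1) by (intro exI[of _ "s(N := e)"]) simp
qed

lemma average_le_of_small_initial_segments: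
  fixes a :: "'e \<Rightarrow> nat \<Rightarrow> real"
  assumes lim: "\<And>e. e \<in> S \<Longrightarrow> a e \<longlonglongrightarrow> 0" and bound: "\<And>e k. e \<in> S \<Longrightarrow> a e k \<le> C" and "0 \<le> C"
    and small: "\<And>K \<eta>. \<eta> > 0 \<Longrightarrow> \<exists>e\<in>S. \<forall>k<K. a e k \<le> \<eta>" and "\<eta> > 0"
  shows "\<exists>s N. N > 0 \<and> (\<forall>i. s i \<in> S) \<and> (\<forall>k. (\<Sum>i<N. a (s i) k) \<le> real N * \<eta>)"
proof -
  \<comment> \<open>With this many sequences the single cost \<open>C\<close> takes less than half
    of the budget \<open>real N * \<eta>\<close>; the other half pays for the steps.\<close>
  obtain N :: nat where N: "2 * C / \<eta> < real N" using reals_Archimedean2 by blast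
  then have "C < real N * (\<eta> / 2)" using \<open>\<eta> > 0\<close> by (simp add: field_simps)
  then have "N > 0" using \<open>0 \<le> C\<close> by (cases N) auto
  have "\<eta> / 2 > 0" using \<open>\<eta> > 0\<close> by simp
  then have "\<exists>s. (\<forall>i. s i \<in> S) \<and> (\<forall>k. (\<Sum>i<N. a (s i) k) \<le> C + real N * (\<eta> / 2))"
    by (intro sum_le_of_small_initial_segments lim bound \<open>0 \<le> C\<close> small)
  then obtain s where s: "\<And>i. s i \<in> S" "\<And>k. (\<Sum>i<N. a (s i) k) \<le> C + real N * (\<eta> / 2)"
    by blast
  have "(\<Sum>i<N. a (s i) k) \<le> real N * \<eta>" for k
  proof -
    have "real N * \<eta> = real N * (\<eta> / 2) + real N * (\<eta> / 2)" by simp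
    then show ?thesis using s(2)[of k] \<open>C < real N * (\<eta> / 2)\<close> by linarith
  qed
  then show ?thesis using \<open>N > 0\<close> s(1) by blast
qed

section \<open>Powers on the unit circle\<close>

lemma power_int_measurable [measurable (raw)]:
  fixes f :: "'a \<Rightarrow> complex"
  assumes "f \<in> borel_measurable M"
  shows "(\<lambda>x. f x powi n) \<in> borel_measurable M"
  unfolding power_int_def using assms by (cases "n \<ge> 0") simp_all

text \<open>Inversion is an isometry of the circle, so negative exponents reduce to positive powers
  of the inverses.\<close>

lemma norm_power_int_diff_le:
  fixes z w :: complex
  assumes "norm z = 1" "norm w = 1"
  shows "norm (z powi n - w powi n) \<le> \<bar>real_of_int n\<bar> * norm (z - w)"
proof (cases "n \<ge> 0")
  case True
  then show ?thesis using norm_power_diff[of z w "nat n"] assms by (simp add: power_int_def)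
next
  case False
  have "z \<noteq> 0" "w \<noteq> 0" using assms by auto
  then have "norm (inverse z - inverse w) = norm (z - w)"
    using assms by (simp add: inverse_diff_inverse norm_mult norm_inverse norm_minus_commute)
  then show ?thesis
    using False norm_power_diff[of "inverse z" "inverse w" "nat (- n)"] assms
    by (simp add: power_int_def norm_inverse)
qed

lemma norm_quotient_power_int:
  fixes z w :: complex
  assumes "norm z = 1" "norm w = 1"
  shows "norm ((z / w) powi n - 1) = norm (z powi n - w powi n)"
proof -
  have "w \<noteq> 0" using assms by auto
  then have "(z / w) powi n - 1 = (z powi n - w powi n) / w powi n"
    by (simp add: power_int_divide_distrib diff_divide_distrib)
  then show ?thesis using assms by (simp add: norm_divide norm_power_int)
qed

lemma norm_diff_one_power2:
  fixes w :: complex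
  assumes "norm w = 1"
  shows "(norm (w - 1))\<^sup>2 = 2 - 2 * Re w"
  using assms cmod_power2[of w] by (simp add: cmod_power2 power2_diff)

section \<open>Continuous measures on the circle\<close>

text \<open>
  Measures on the circle are viewed as measures on the plane carried by the circle, so that the
  product measures are Borel measures on a second countable type.
\<close>

locale circle_measure = prob_space \<nu> for \<nu> :: "complex measure" +
  assumes sets_nu [measurable_cong, simp]: "sets \<nu> = sets borel"
    and on_circle: "AE z in \<nu>. norm z = 1"
    and continuous: "\<And>z. emeasure \<nu> {z} = 0"

text \<open>For unimodular \<open>w\<close> the square of \<open>norm (w - 1)\<close> is
  \<open>2 - 2 * Re w\<close>. Integration at \<open>w = z powi m\<close> turns convergence of the
  Fourier coefficients to 1 into L2 convergence of the powers to 1.\<close>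

lemma rigidity_sequence_circle_measure:
  assumes "rigidity_sequence n"
  obtains \<nu> where "circle_measure \<nu>" "(\<lambda>k. \<integral>z. (norm (z powi n k - 1))\<^sup>2 \<partial>\<nu>) \<longlonglongrightarrow> 0"
proof -
  obtain \<mu> where prob: "prob_space \<mu>" and sets: "sets \<mu> = sets (restrict_space borel (sphere (0::complex) 1))"
    and cont: "\<And>z. z \<in> sphere 0 1 \<Longrightarrow> emeasure \<mu> {z} = 0"
    and lim: "(\<lambda>k. fourier_coeff \<mu> (n k)) \<longlonglongrightarrow> 1"
    using assms by (auto simp: rigidity_sequence_def circle_prob_cont_def circle_prob_def)
  interpret \<mu>: prob_space \<mu> by fact
  have space: "space \<mu> = sphere 0 1"
    using sets_eq_imp_space_eq[OF sets] by (simp add: space_restrict_space)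
  have [measurable]: "(\<lambda>z. z) \<in> measurable \<mu> borel"
    using measurable_restrict_space1[of "\<lambda>z. z" borel borel "sphere (0::complex) 1"] sets
    by (simp cong: measurable_cong_sets)
  \<comment> \<open>The image of the measure under the inclusion of the circle into the
    plane.\<close>
  define \<nu> where "\<nu> = distr \<mu> borel (\<lambda>z. z)"
  have "circle_measure \<nu>"
  proof (intro circle_measure.intro circle_measure_axioms.intro)
    show "prob_space \<nu>" unfolding \<nu>_def by (rule \<mu>.prob_space_distr) measurable
    show "sets \<nu> = sets borel" by (simp add: \<nu>_def)
    show "AE z in \<nu>. norm z = 1"
      unfolding \<nu>_def by (subst AE_distr_iff) (auto simp: space intro!: AE_I2)
    show "emeasure \<nu> {z} = 0" for z
    proof -
      \<comment> \<open>A point off the circle has empty preimage, so continuity extends to all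
        points of the plane.\<close>
      have "emeasure \<nu> {z} = emeasure \<mu> ({z} \<inter> sphere 0 1)"
        unfolding \<nu>_def by (subst emeasure_distr) (simp_all add: space vimage_def)
      also have "\<dots> = 0" using cont[of z] by (cases "z \<in> sphere 0 1") auto
      finally show ?thesis .
    qed
  qed
  moreover have "(\<lambda>k. \<integral>z. (norm (z powi n k - 1))\<^sup>2 \<partial>\<nu>) \<longlonglongrightarrow> 0"
  proof -
    have "(\<integral>z. (norm (z powi m - 1))\<^sup>2 \<partial>\<nu>) = 2 - 2 * Re (fourier_coeff \<mu> m)" for m
    proof -
      have int: "integrable \<mu> (\<lambda>z. z powi m)"
        by (rule \<mu>.integrable_const_bound[where B = 1])
          (auto simp: space norm_power_int intro!: AE_I2)
      have "(\<integral>z. (norm (z powi m - 1))\<^sup>2 \<partial>\<nu>) = (\<integral>z. (norm (z powi m - 1))\<^sup>2 \<partial>\<mu>)"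
        unfolding \<nu>_def by (rule integral_distr) measurable
      also have "\<dots> = (\<integral>z. 2 - 2 * Re (z powi m) \<partial>\<mu>)"
        by (intro Bochner_Integration.integral_cong norm_diff_one_power2)
          (simp_all add: space norm_power_int)
      also have "\<dots> = 2 - 2 * Re (fourier_coeff \<mu> m)"
        using int by (simp add: fourier_coeff_def \<mu>.prob_space)
      finally show ?thesis .
    qed
    moreover have "(\<lambda>k. 2 - 2 * Re (fourier_coeff \<mu> (n k))) \<longlonglongrightarrow> 2 - 2 * Re 1"
      by (intro tendsto_intros lim)
    ultimately show ?thesis by simp
  qed
  ultimately show ?thesis ..
qed

section \<open>The quotient of the coordinates under the product measure\<close>

context circle_measure
begin

sublocale P: pair_prob_space \<nu> \<nu> ..

abbreviation "\<nu>\<nu> \<equiv> \<nu> \<Otimes>\<^sub>M \<nu>"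

definition \<phi> :: "complex \<times> complex \<Rightarrow> complex" where
  "\<phi> p = fst p / snd p"

lemma sets_nunu: "sets \<nu>\<nu> = sets borel"
  unfolding sets_pair_measure_cong[OF sets_nu sets_nu] borel_prod ..

lemma space_nu [simp]: "space \<nu> = UNIV"
  using sets_eq_imp_space_eq[OF sets_nu] by simp

lemma phi_measurable [measurable]: "\<phi> \<in> borel_measurable \<nu>\<nu>"
  unfolding \<phi>_def[abs_def] by measurable

lemma AE_nunu_circle: "AE p in \<nu>\<nu>. norm (fst p) = 1 \<and> norm (snd p) = 1"
proof (rule P.AE_pair_measure)
  show "AE x in \<nu>. AE y in \<nu>. norm (fst (x, y)) = 1 \<and> norm (snd (x, y)) = 1"
    using on_circle
  proof eventually_elim
    case (elim x)
    show ?case using on_circle by eventually_elim (simp add: elim)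
  qed
qed measurable

text \<open>By Fubini the diagonal is null, since its slices are points. On pairs of circle points
  the quotient equals 1 only on the diagonal.\<close>

lemma AE_nunu_phi_ne_1: "AE p in \<nu>\<nu>. \<phi> p \<noteq> 1"
proof -
  have "AE p in \<nu>\<nu>. fst p \<noteq> snd p"
  proof (rule P.AE_pair_measure)
    have "AE y in \<nu>. x \<noteq> y" for x
      using continuous[of x] by (intro AE_I[of _ _ "{x}"]) auto
    then show "AE x in \<nu>. AE y in \<nu>. fst (x, y) \<noteq> snd (x, y)" by simp
  qed measurable
  then show ?thesis using AE_nunu_circle by eventually_elim (auto simp: \<phi>_def)
qed

lemma unimodular_phi: "unimodular \<nu>\<nu> \<phi>"
proof
  show "AE p in \<nu>\<nu>. norm (\<phi> p) = 1"
    using AE_nunu_circle by eventually_elim (simp add: \<phi>_def norm_divide)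
qed measurable

section \<open>Mean deviations over squares of sets\<close>

definition deviation :: "int \<Rightarrow> complex \<times> complex \<Rightarrow> real" where
  "deviation m p = (norm (\<phi> p powi m - 1))\<^sup>2"

lemma deviation_measurable [measurable]: "deviation m \<in> borel_measurable \<nu>\<nu>"
  unfolding deviation_def[abs_def] by measurable

lemma deviation_nonneg [simp]: "0 \<le> deviation m p"
  by (simp add: deviation_def)

lemma AE_deviation:
  "AE p in \<nu>\<nu>. deviation m p = (norm (fst p powi m - snd p powi m))\<^sup>2"
  using AE_nunu_circle by eventually_elim (simp add: deviation_def \<phi>_def norm_quotient_power_int)

text \<open>Both powers are unimodular almost everywhere, which gives 2 * 1 + 2 * 1.\<close>

lemma AE_deviation_le_4: "AE p in \<nu>\<nu>. deviation m p \<le> 4"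
  using AE_deviation[of m] AE_nunu_circle
proof eventually_elim
  case (elim p)
  then show ?case
    using norm_diff_power2_le[of "fst p powi m" "snd p powi m"] by (simp add: norm_power_int)
qed

text \<open>The conditional mean of the deviation given \<open>E \<times> E\<close>; by
  \<open>prob_Times\<close> the denominator is the probability of that square.\<close>

definition square_avg :: "complex set \<Rightarrow> int \<Rightarrow> real" where
  "square_avg E m = (\<integral>p. indicator (E \<times> E) p * deviation m p \<partial>\<nu>\<nu>) / (prob E)\<^sup>2"

lemma Times_measurable [measurable]: "E \<in> sets borel \<Longrightarrow> E \<times> E \<in> sets \<nu>\<nu>"
  by simp

lemma prob_Times:
  assumes "E \<in> sets borel"
  shows "P.prob (E \<times> E) = (prob E)\<^sup>2"
  using assms emeasure_pair_measure_Times[of E \<nu> E]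
  by (simp add: measure_def enn2real_mult power2_eq_square)

lemma integrable_indicator_deviation:
  assumes [measurable]: "E \<in> sets borel"
  shows "integrable \<nu>\<nu> (\<lambda>p. indicator (E \<times> E) p * deviation m p)"
proof (rule P.integrable_const_bound[where B = 4])
  show "AE p in \<nu>\<nu>. norm (indicator (E \<times> E) p * deviation m p) \<le> 4"
    using AE_deviation_le_4 by eventually_elim (auto simp: indicator_def)
qed measurable

lemma square_avg_le:
  assumes E: "E \<in> sets borel" "prob E > 0"
    and le: "AE p in \<nu>\<nu>. p \<in> E \<times> E \<longrightarrow> deviation m p \<le> C"
  shows "square_avg E m \<le> C"
proof -
  have "(\<integral>p. indicator (E \<times> E) p * deviation m p \<partial>\<nu>\<nu>) \<le> (\<integral>p. C * indicator (E \<times> E) p \<partial>\<nu>\<nu>)"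
  proof (rule integral_mono_AE)
    show "integrable \<nu>\<nu> (\<lambda>p. C * indicator (E \<times> E) p)"
      using E by (intro integrable_mult_right integrable_real_indicator) (auto simp: less_top[symmetric])
    show "AE p in \<nu>\<nu>. indicator (E \<times> E) p * deviation m p \<le> C * indicator (E \<times> E) p"
      using le by eventually_elim (auto simp: indicator_def)
  qed (rule integrable_indicator_deviation[OF E(1)])
  also have "\<dots> = C * (prob E)\<^sup>2" using E(1) by (simp add: prob_Times)
  finally show ?thesis using E by (simp add: square_avg_def divide_le_eq)
qed

text \<open>Comparing both powers with 1 splits the deviation into one function of each coordinate,
  and both marginals are \<open>\<nu>\<close>. For fixed \<open>E\<close> this makes the mean vanish
  along a rigidity sequence.\<close>

lemma square_avg_le_integral:
  assumes E: "E \<in> sets borel" "prob E > 0"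
  shows "square_avg E m \<le> 4 * (\<integral>z. (norm (z powi m - 1))\<^sup>2 \<partial>\<nu>) / (prob E)\<^sup>2"
proof -
  define g :: "complex \<Rightarrow> real" where "g z = (norm (z powi m - 1))\<^sup>2" for z
  have [measurable]: "g \<in> borel_measurable borel" unfolding g_def[abs_def] by measurable
  have g: "AE z in \<nu>. g z \<le> 4"
    using on_circle
  proof eventually_elim
    case (elim z)
    then show ?case using norm_diff_power2_le[of "z powi m" 1] by (simp add: g_def norm_power_int)
  qed
  have int: "integrable \<nu> g"
    by (rule integrable_const_bound[where B = 4]) (use g in \<open>auto simp: g_def\<close>)
  \<comment> \<open>The first marginal is read off from the image measure, the second follows by
    swapping the coordinates.\<close>
  have distr: "distr \<nu>\<nu> \<nu> fst = \<nu>" by (rule distr_pair_fst)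
  have fst: "integrable \<nu>\<nu> (\<lambda>p. g (fst p))" "(\<integral>p. g (fst p) \<partial>\<nu>\<nu>) = (\<integral>z. g z \<partial>\<nu>)"
    using integrable_distr[of fst \<nu>\<nu> \<nu> g] integral_distr[of fst \<nu>\<nu> \<nu> g] int by (simp_all add: distr)
  have snd: "integrable \<nu>\<nu> (\<lambda>p. g (snd p))" "(\<integral>p. g (snd p) \<partial>\<nu>\<nu>) = (\<integral>z. g z \<partial>\<nu>)"
    using P.integrable_product_swap[OF fst(1)] P.integral_product_swap[of "\<lambda>p. g (fst p)"] fst(2)
    by (simp_all add: case_prod_beta')
  have "(\<integral>p. indicator (E \<times> E) p * deviation m p \<partial>\<nu>\<nu>) \<le> (\<integral>p. 2 * g (fst p) + 2 * g (snd p) \<partial>\<nu>\<nu>)"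
  proof (rule integral_mono_AE)
    show "AE p in \<nu>\<nu>. indicator (E \<times> E) p * deviation m p \<le> 2 * g (fst p) + 2 * g (snd p)"
      using AE_deviation[of m]
    proof eventually_elim
      case (elim p)
      have "indicator (E \<times> E) p * deviation m p \<le> deviation m p" by (simp add: indicator_def)
      also have "\<dots> \<le> 2 * g (fst p) + 2 * g (snd p)"
        using elim norm_diff_power2_le[of "fst p powi m - 1" "snd p powi m - 1"] by (simp add: g_def)
      finally show ?case .
    qed
  qed (use fst snd in \<open>auto intro: integrable_indicator_deviation[OF E(1)]\<close>)
  also have "\<dots> = 4 * (\<integral>z. g z \<partial>\<nu>)" using fst snd by simp
  finally show ?thesis using E by (simp add: square_avg_def g_def divide_right_mono)
qed

lemma square_avg_nonneg: "0 \<le> square_avg E m"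
  by (simp add: square_avg_def integral_nonneg)

text \<open>Countably many balls of radius \<open>\<delta> / 2\<close> about a dense set cover the
  plane, so they cannot all be null.\<close>

lemma ex_small_set:
  assumes "\<delta> > 0"
  obtains E where "E \<in> sets borel" "prob E > 0" "\<And>z w. z \<in> E \<Longrightarrow> w \<in> E \<Longrightarrow> norm (z - w) \<le> \<delta>"
proof -
  obtain D :: "complex set" where D: "countable D" "\<And>W. open W \<Longrightarrow> W \<noteq> {} \<Longrightarrow> \<exists>d\<in>D. d \<in> W"
    using countable_dense_setE by metis
  have "\<exists>d\<in>D. prob (ball d (\<delta> / 2)) > 0"
  proof (rule ccontr)
    assume "\<not> ?thesis"
    then have "prob (ball d (\<delta> / 2)) = 0" if "d \<in> D" for d
      using that by (meson measure_nonneg linorder_not_less order_antisym)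
    then have "(\<Union>d\<in>D. ball d (\<delta> / 2)) \<in> null_sets \<nu>"
      using D(1) by (intro null_sets_UN') (auto simp: null_sets_def emeasure_eq_measure)
    moreover have "(\<Union>d\<in>D. ball d (\<delta> / 2)) = UNIV"
    proof -
      have "\<exists>d\<in>D. z \<in> ball d (\<delta> / 2)" for z
        using D(2)[of "ball z (\<delta> / 2)"] assms by (auto simp: dist_commute)
      then show ?thesis by blast
    qed
    ultimately show False using emeasure_space_1 by (auto simp: null_sets_def)
  qed
  then obtain d where d: "prob (ball d (\<delta> / 2)) > 0" by blast
  have "norm (z - w) \<le> \<delta>" if "z \<in> ball d (\<delta> / 2)" "w \<in> ball d (\<delta> / 2)" for z w
    using dist_triangle_half_r[of d z \<delta> w] that by (simp add: dist_norm)
  with d show ?thesis by (intro that[of "ball d (\<delta> / 2)"]) auto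
qed

text \<open>\<open>average_le_of_small_initial_segments\<close> is applied to the means over squares
  of sets of positive measure: each vanishes as \<open>k\<close> grows, and sets of small diameter
  make any initial segment small. The averaged conditioned measures form \<open>M\<close>.\<close>

lemma ex_prob_space_small_deviation:
  assumes lim: "(\<lambda>k. \<integral>z. (norm (z powi n k - 1))\<^sup>2 \<partial>\<nu>) \<longlonglongrightarrow> 0" and "\<eta> > 0"
  obtains M where "prob_space M" "sets M = sets borel" "unimodular M \<phi>" "AE p in M. \<phi> p \<noteq> 1"
    "\<And>k. (\<integral>p. deviation (n k) p \<partial>M) \<le> \<eta>"
proof -
  define S where "S = {E \<in> sets borel. prob E > 0}"
  have small: "\<exists>E\<in>S. \<forall>k<K. square_avg E (n k) \<le> e" if "e > 0" for K e
  proof -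
    \<comment> \<open>A common bound for the exponents in the initial segment; the summand 1 keeps
      it positive.\<close>
    define B where "B = (\<Sum>k<K. \<bar>real_of_int (n k)\<bar>) + 1"
    have B: "\<bar>real_of_int (n k)\<bar> \<le> B" if "k < K" for k
      using member_le_sum[of k "{..<K}" "\<lambda>k. \<bar>real_of_int (n k)\<bar>"] that by (simp add: B_def)
    have "B > 0" unfolding B_def by (intro add_nonneg_pos sum_nonneg) auto
    \<comment> \<open>Chosen so that the Lipschitz bound \<open>B * \<delta>\<close> equals
      \<open>sqrt e\<close>, whose square is the required deviation.\<close>
    define \<delta> where "\<delta> = sqrt e / B"
    have "\<delta> > 0" using \<open>e > 0\<close> \<open>B > 0\<close> by (simp add: \<delta>_def)
    then obtain E where E: "E \<in> sets borel" "prob E > 0"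
      "\<And>z w. z \<in> E \<Longrightarrow> w \<in> E \<Longrightarrow> norm (z - w) \<le> \<delta>" using ex_small_set by blast
    have "square_avg E (n k) \<le> e" if "k < K" for k
    proof (rule square_avg_le[OF E(1,2)])
      show "AE p in \<nu>\<nu>. p \<in> E \<times> E \<longrightarrow> deviation (n k) p \<le> e"
        using AE_deviation[of "n k"] AE_nunu_circle
      proof eventually_elim
        case (elim p)
        show ?case
        proof
          assume p: "p \<in> E \<times> E"
          have "norm (fst p powi n k - snd p powi n k) \<le> \<bar>real_of_int (n k)\<bar> * norm (fst p - snd p)"
            using elim by (intro norm_power_int_diff_le) auto
          also have "\<dots> \<le> B * \<delta>"
            using B[OF that] E(3)[of "fst p" "snd p"] p \<open>B > 0\<close> by (intro mult_mono) auto
          also have "\<dots> = sqrt e" using \<open>B > 0\<close> by (simp add: \<delta>_def)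
          finally have "(norm (fst p powi n k - snd p powi n k))\<^sup>2 \<le> (sqrt e)\<^sup>2"
            by (rule power_mono) simp
          then show "deviation (n k) p \<le> e" using elim \<open>e > 0\<close> by simp
        qed
      qed
    qed
    then show ?thesis using E by (auto simp: S_def)
  qed
  have vanish: "(\<lambda>k. square_avg E (n k)) \<longlonglongrightarrow> 0" if "E \<in> S" for E
  proof (rule tendsto_sandwich[OF _ _ tendsto_const])
    show "\<forall>\<^sub>F k in sequentially. 0 \<le> square_avg E (n k)" by (simp add: square_avg_nonneg)
    show "\<forall>\<^sub>F k in sequentially. square_avg E (n k)
        \<le> 4 * (\<integral>z. (norm (z powi n k - 1))\<^sup>2 \<partial>\<nu>) / (prob E)\<^sup>2"
      using that by (intro always_eventually allI square_avg_le_integral) (auto simp: S_def)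
    have "(\<lambda>k. 4 * (\<integral>z. (norm (z powi n k - 1))\<^sup>2 \<partial>\<nu>) / (prob E)\<^sup>2) \<longlonglongrightarrow> 4 * 0 / (prob E)\<^sup>2"
      using that by (intro tendsto_intros lim) (auto simp: S_def)
    then show "(\<lambda>k. 4 * (\<integral>z. (norm (z powi n k - 1))\<^sup>2 \<partial>\<nu>) / (prob E)\<^sup>2) \<longlonglongrightarrow> 0" by simp
  qed
  have le_4: "square_avg E (n k) \<le> 4" if "E \<in> S" for E k
    using that AE_deviation_le_4[of "n k"] by (intro square_avg_le) (auto simp: S_def)
  have "\<exists>s N. N > 0 \<and> (\<forall>i. s i \<in> S) \<and> (\<forall>k. (\<Sum>i<N. square_avg (s i) (n k)) \<le> real N * \<eta>)"
    by (rule average_le_of_small_initial_segments[where a = "\<lambda>E k. square_avg E (n k)",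
          OF vanish le_4 zero_le_numeral small \<open>\<eta> > 0\<close>])
  then obtain s and N :: nat where N: "N > 0" and s: "\<And>i. s i \<in> S"
    and avg: "\<And>k. (\<Sum>i<N. square_avg (s i) (n k)) \<le> real N * \<eta>"
    by blast
  have [measurable]: "s i \<in> sets borel" and s_pos: "prob (s i) > 0" for i
    using s[of i] by (auto simp: S_def)
  \<comment> \<open>The density, with respect to the product measure, of the average of the
    \<open>N\<close> measures conditioned on the squares.\<close>
  define h where "h p = (\<Sum>i<N. indicator (s i \<times> s i) p / (prob (s i))\<^sup>2) / real N" for p
  have h_nonneg: "0 \<le> h p" for p by (simp add: h_def sum_nonneg)
  have [measurable]: "h \<in> borel_measurable \<nu>\<nu>" unfolding h_def[abs_def] by measurable
  define M where "M = density \<nu>\<nu> (\<lambda>p. ennreal (h p))"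
  have int_ind: "integrable \<nu>\<nu> (indicator (s i \<times> s i) :: _ \<Rightarrow> real)" for i
    by (intro integrable_real_indicator) (auto simp: less_top[symmetric])
  have int_h: "integrable \<nu>\<nu> h"
    unfolding h_def[abs_def] by (intro integrable_divide Bochner_Integration.integrable_sum int_ind)
  have "(\<integral>p. h p \<partial>\<nu>\<nu>) = 1"
  proof -
    have "(\<integral>p. h p \<partial>\<nu>\<nu>) = (\<Sum>i<N. (\<integral>p. indicator (s i \<times> s i) p \<partial>\<nu>\<nu>) / (prob (s i))\<^sup>2) / real N"
      unfolding h_def using int_ind by (simp add: Bochner_Integration.integral_sum)
    also have "\<dots> = 1" using N s_pos by (simp add: prob_Times less_imp_neq[symmetric])
    finally show ?thesis .
  qed
  moreover have "emeasure M (space M) = (\<integral>\<^sup>+p. ennreal (h p) \<partial>\<nu>\<nu>)"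
    unfolding M_def space_density by (subst emeasure_density[OF _ sets.top]) (auto intro!: nn_integral_cong)
  ultimately have "emeasure M (space M) = 1"
    using int_h h_nonneg by (simp add: nn_integral_eq_integral)
  then have "prob_space M" by (rule prob_spaceI)
  have sets_M: "sets M = sets borel" unfolding M_def sets_density sets_nunu ..
  \<comment> \<open>\<open>M\<close> is absolutely continuous, so unimodularity and avoidance of the
    value 1 carry over from the product measure.\<close>
  have AE_M: "AE p in M. Q p" if "AE p in \<nu>\<nu>. Q p" for Q
  proof -
    have "AE p in \<nu>\<nu>. 0 < ennreal (h p) \<longrightarrow> Q p" using that by eventually_elim simp
    then show ?thesis unfolding M_def by (subst AE_density) simp_all
  qed
  have "unimodular M \<phi>"
  proof
    show "\<phi> \<in> borel_measurable M" by (simp add: M_def)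
    show "AE p in M. norm (\<phi> p) = 1"
      by (intro AE_M unimodular.norm_phi unimodular_phi)
  qed
  moreover have "AE p in M. \<phi> p \<noteq> 1" by (intro AE_M AE_nunu_phi_ne_1)
  moreover have "(\<integral>p. deviation (n k) p \<partial>M) \<le> \<eta>" for k
  proof -
    have "(\<integral>p. deviation (n k) p \<partial>M) = (\<integral>p. h p * deviation (n k) p \<partial>\<nu>\<nu>)"
      unfolding M_def by (subst integral_density) (simp_all add: h_nonneg)
    also have "\<dots> = (\<integral>p. (\<Sum>i<N. indicator (s i \<times> s i) p * deviation (n k) p / (prob (s i))\<^sup>2) / real N \<partial>\<nu>\<nu>)"
      by (simp add: h_def sum_distrib_right)
    also have "\<dots> = (\<Sum>i<N. square_avg (s i) (n k)) / real N"
      using integrable_indicator_deviation by (simp add: Bochner_Integration.integral_sum square_avg_def)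
    also have "\<dots> \<le> \<eta>" using avg[of k] N by (simp add: divide_le_eq mult.commute)
    finally show ?thesis .
  qed
  ultimately show ?thesis using \<open>prob_space M\<close> sets_M by (intro that)
qed

end

theorem corollary3p2:
  fixes n :: "nat \<Rightarrow> int"
  assumes "rigidity_sequence n"
  shows "\<not> kazhdan_sequence n"
proof
  assume "kazhdan_sequence n"
  then obtain \<epsilon> where "\<epsilon> > 0" and K: "kazhdan_pair TYPE(nat \<Rightarrow> complex) (range n) \<epsilon>"
    by (auto simp: kazhdan_sequence_def kazhdan_set_def)
  obtain \<nu> where \<nu>: "circle_measure \<nu>" and lim: "(\<lambda>k. \<integral>z. (norm (z powi n k - 1))\<^sup>2 \<partial>\<nu>) \<longlonglongrightarrow> 0"
    by (rule rigidity_sequence_circle_measure[OF assms])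
  interpret circle_measure \<nu> by fact
  \<comment> \<open>The deviation is a squared norm, so this bound corresponds to displacement at
    most \<open>\<epsilon> / 2\<close>, and the Kazhdan pair would force
    \<open>\<epsilon> \<le> \<epsilon> / 2\<close>.\<close>
  have "(\<epsilon> / 2)\<^sup>2 > 0" using \<open>\<epsilon> > 0\<close> by simp
  with lim obtain M where M: "prob_space M" "sets M = sets borel" "unimodular M \<phi>" "AE p in M. \<phi> p \<noteq> 1"
    "\<And>k. (\<integral>p. deviation (n k) p \<partial>M) \<le> (\<epsilon> / 2)\<^sup>2"
    using ex_prob_space_small_deviation by blast
  have "\<epsilon> \<le> \<epsilon> / 2"
    using M(5) \<open>\<epsilon> > 0\<close> by (intro kazhdan_pair_unimodular[OF K M(1-4)]) (auto simp: deviation_def)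
  then show False using \<open>\<epsilon> > 0\<close> by simp
qed

end
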